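(* Let $A$ be a finitely generated abelian group and let $G$ be a non-torsion group which is self-similar and finite-state with respect to some simple $G$-data. Then the restricted wreath product $A\wr G$ is isomorphic to a subgroup of $\mathcal F_n$ for some $n\ge2$; equivalently, $A\wr G$ is a subgroup of an automata group.
   Context: For $m\ge2$, $\mathcal T_m$ is the one-rooted $m$-regular tree with vertices the finite words over $\{1,\dots,m\}$, $\mathcal A_m$ its automorphism group, each $\alpha\in\mathcal A_m$ written $\alpha=(\alpha_1,\dots,\alpha_m)\sigma(\alpha)$ with $\sigma(\alpha)\in S_m$ the first-level action and $\alpha_i$ the states; $Q(\alpha)=\{\alpha\}\cup\bigcup_iQ(\alpha_i)$, $\alpha$ is finite-state if $Q(\alpha)$ is finite, and $\mathcal F_m$ is the group of finite-state automorphisms. A subgroup $G\le \mathcal A_m$ is self-similar if $Q(\alpha)\subseteq G$ for all $\alpha\in G$; an automata group is a finitely generated self-similar subgroup of some $\mathcal F_m$. Conventions: maps written on the right. A virtual endomorphism of $G$ is a homomorphism $f:H\to G$ from a finite-index subgroup. A $G$-data $(\mathbf m,\mathbf H,\mathbf F)$ consists of subgroups $H_1,\dots,H_s$ with $[G:H_i]=m_i$, $\mathbf m=(m_1,\dots,m_s)$, $m=\sum m_i$, and virtual endomorphisms $f_i:H_i\to G$. Choosing right transversals $T_i$ of $H_i$, with $\theta_i(g,t)=tg(t')^{-1}$ where $H_it'=H_itg$ and $g^\sigma$ the permutation $t\mapsto t'$ of $T_1\sqcup\dots\sqcup T_s\cong\{1,\dots,m\}$, the data induces $\varphi:G\to\mathcal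 A_m$, $g^\varphi=((\theta_i(g,t)^{f_i})^\varphi\mid t\in T_i,1\le i\le s)\,g^\sigma$, whose kernel is the $\mathbf F$-core: the largest subgroup of $\bigcap_iH_i$ normal in $G$ and $f_i$-invariant for all $i$. The data is simple if the $\mathbf F$-core is trivial; $G$ is finite-state with respect to a simple data if for some choice of transversals $G^\varphi\le\mathcal F_m$. *)

theory Defs
  imports "HOL-Algebra.Algebra"
begin

text \<open>Vertices: finite words over the alphabet {0..<m} (the paper uses {1,...,m}).
  Automorphisms are functions on all nat lists that act as identity outside the tree.
  Maps are written on the right: the product of a and b is "first a, then b".\<close>

definition words :: "nat \<Rightarrow> nat list set" where
  "words m = {w. set w \<subseteq> {..<m}}"

definition tree_aut :: "nat \<Rightarrow> (nat list \<Rightarrow> nat list) \<Rightarrow> bool" where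
  "tree_aut m \<alpha> \<longleftrightarrow> bij_betw \<alpha> (words m) (words m)
     \<and> (\<forall>w. w \<notin> words m \<longrightarrow> \<alpha> w = w)
     \<and> (\<forall>w\<in>words m. length (\<alpha> w) = length w \<and> (\<forall>k. \<alpha> (take k w) = take k (\<alpha> w)))"

definition state :: "nat \<Rightarrow> (nat list \<Rightarrow> nat list) \<Rightarrow> nat \<Rightarrow> (nat list \<Rightarrow> nat list)" where
  "state m \<alpha> i = (\<lambda>w. if w \<in> words m then tl (\<alpha> (i # w)) else w)"

inductive_set Qset :: "nat \<Rightarrow> (nat list \<Rightarrow> nat list) \<Rightarrow> (nat list \<Rightarrow> nat list) set"
  for m :: nat and \<alpha> :: "nat list \<Rightarrow> nat list" where
  base: "\<alpha> \<in> Qset m \<alpha>"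
| step: "\<beta> \<in> Qset m \<alpha> \<Longrightarrow> i < m \<Longrightarrow> state m \<beta> i \<in> Qset m \<alpha>"

definition finite_state :: "nat \<Rightarrow> (nat list \<Rightarrow> nat list) \<Rightarrow> bool" where
  "finite_state m \<alpha> \<longleftrightarrow> finite (Qset m \<alpha>)"

definition aut_group :: "nat \<Rightarrow> (nat list \<Rightarrow> nat list) monoid" where
  "aut_group m = \<lparr>carrier = {\<alpha>. tree_aut m \<alpha>}, monoid.mult = (\<lambda>\<alpha> \<beta>. \<beta> \<circ> \<alpha>), one = id\<rparr>"

definition fs_group :: "nat \<Rightarrow> (nat list \<Rightarrow> nat list) monoid" where
  "fs_group m = \<lparr>carrier = {\<alpha>. tree_aut m \<alpha> \<and> finite_state m \<alpha>}, monoid.mult = (\<lambda>\<alpha> \<beta>. \<beta> \<circ> \<alpha>), one = id\<rparr>"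

definition self_similar :: "nat \<Rightarrow> (nat list \<Rightarrow> nat list) set \<Rightarrow> bool" where
  "self_similar m S \<longleftrightarrow> (\<forall>\<alpha>\<in>S. Qset m \<alpha> \<subseteq> S)"

definition wreath :: "('a, 'c) monoid_scheme \<Rightarrow> ('g, 'd) monoid_scheme \<Rightarrow> (('g \<Rightarrow> 'a) \<times> 'g) monoid" where
  "wreath A G = \<lparr>carrier = {(\<phi>, g). \<phi> \<in> extensional (carrier G) \<and> \<phi> \<in> carrier G \<rightarrow> carrier A
                     \<and> finite {x \<in> carrier G. \<phi> x \<noteq> \<one>\<^bsub>A\<^esub>} \<and> g \<in> carrier G},
     monoid.mult = (\<lambda>(\<phi>1, g1) (\<phi>2, g2). (\<lambda>x\<in>carrier G. \<phi>1 x \<otimes>\<^bsub>A\<^esub> \<phi>2 (x \<otimes>\<^bsub>G\<^esub> g1), g1 \<otimes>\<^bsub>G\<^esub> g2)),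
     one = (\<lambda>x\<in>carrier G. \<one>\<^bsub>A\<^esub>, \<one>\<^bsub>G\<^esub>)\<rparr>"

definition G_data :: "('g, 'b) monoid_scheme \<Rightarrow> nat \<Rightarrow> (nat \<Rightarrow> 'g set) \<Rightarrow> (nat \<Rightarrow> 'g \<Rightarrow> 'g) \<Rightarrow> bool" where
  "G_data G s H f \<longleftrightarrow> 0 < s \<and> (\<forall>i<s. subgroup (H i) G \<and> finite (rcosets\<^bsub>G\<^esub> (H i))
      \<and> f i \<in> hom (G\<lparr>carrier := H i\<rparr>) G)"

definition data_m :: "('g, 'b) monoid_scheme \<Rightarrow> nat \<Rightarrow> (nat \<Rightarrow> 'g set) \<Rightarrow> nat" where
  "data_m G s H = (\<Sum>i<s. card (rcosets\<^bsub>G\<^esub> (H i)))"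

text \<open>The F-core: the largest subgroup of the intersection of the H i that is normal in G and
  f_i-invariant for all i (the subgroup generated by all such subgroups).\<close>
definition F_core :: "('g, 'b) monoid_scheme \<Rightarrow> nat \<Rightarrow> (nat \<Rightarrow> 'g set) \<Rightarrow> (nat \<Rightarrow> 'g \<Rightarrow> 'g) \<Rightarrow> 'g set" where
  "F_core G s H f = generate G (\<Union>{K. K \<lhd> G \<and> K \<subseteq> carrier G \<inter> (\<Inter>i\<in>{..<s}. H i)
                                     \<and> (\<forall>i<s. f i ` K \<subseteq> K)})"

definition simple_data :: "('g, 'b) monoid_scheme \<Rightarrow> nat \<Rightarrow> (nat \<Rightarrow> 'g set) \<Rightarrow> (nat \<Rightarrow> 'g \<Rightarrow> 'g) \<Rightarrow> bool" where
  "simple_data G s H f \<longleftrightarrow> F_core G s H f = {\<one>\<^bsub>G\<^esub>}"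

definition right_transversal :: "('g, 'b) monoid_scheme \<Rightarrow> 'g set \<Rightarrow> 'g set \<Rightarrow> bool" where
  "right_transversal G K T \<longleftrightarrow> T \<subseteq> carrier G
     \<and> (\<forall>a\<in>carrier G. \<exists>!t. t \<in> T \<and> K #>\<^bsub>G\<^esub> t = K #>\<^bsub>G\<^esub> a)"

definition transversal_data :: "('g, 'b) monoid_scheme \<Rightarrow> nat \<Rightarrow> (nat \<Rightarrow> 'g set) \<Rightarrow> (nat \<Rightarrow> 'g set)
     \<Rightarrow> (nat \<Rightarrow> nat \<times> 'g) \<Rightarrow> bool" where
  "transversal_data G s H T e \<longleftrightarrow> (\<forall>i<s. right_transversal G (H i) (T i))
     \<and> bij_betw e {..<data_m G s H} (SIGMA i:{..<s}. T i)"

definition rep :: "('g, 'b) monoid_scheme \<Rightarrow> 'g set \<Rightarrow> 'g set \<Rightarrow> 'g \<Rightarrow> 'g" where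
  "rep G K T a = (THE t. t \<in> T \<and> K #>\<^bsub>G\<^esub> t = K #>\<^bsub>G\<^esub> a)"

definition data_sigma :: "('g, 'b) monoid_scheme \<Rightarrow> nat \<Rightarrow> (nat \<Rightarrow> 'g set) \<Rightarrow> (nat \<Rightarrow> 'g set)
     \<Rightarrow> (nat \<Rightarrow> nat \<times> 'g) \<Rightarrow> 'g \<Rightarrow> nat \<Rightarrow> nat" where
  "data_sigma G s H T e g k = (case e k of (i, t) \<Rightarrow>
      inv_into {..<data_m G s H} e (i, rep G (H i) (T i) (t \<otimes>\<^bsub>G\<^esub> g)))"

definition data_sec :: "('g, 'b) monoid_scheme \<Rightarrow> (nat \<Rightarrow> 'g set) \<Rightarrow> (nat \<Rightarrow> 'g \<Rightarrow> 'g) \<Rightarrow> (nat \<Rightarrow> 'g set)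
     \<Rightarrow> (nat \<Rightarrow> nat \<times> 'g) \<Rightarrow> 'g \<Rightarrow> nat \<Rightarrow> 'g" where
  "data_sec G H f T e g k = (case e k of (i, t) \<Rightarrow>
      f i (t \<otimes>\<^bsub>G\<^esub> g \<otimes>\<^bsub>G\<^esub> inv\<^bsub>G\<^esub> (rep G (H i) (T i) (t \<otimes>\<^bsub>G\<^esub> g))))"

fun data_act :: "('g, 'b) monoid_scheme \<Rightarrow> nat \<Rightarrow> (nat \<Rightarrow> 'g set) \<Rightarrow> (nat \<Rightarrow> 'g \<Rightarrow> 'g) \<Rightarrow> (nat \<Rightarrow> 'g set)
     \<Rightarrow> (nat \<Rightarrow> nat \<times> 'g) \<Rightarrow> 'g \<Rightarrow> nat list \<Rightarrow> nat list" where
  "data_act G s H f T e g [] = []"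
| "data_act G s H f T e g (k # w) =
     data_sigma G s H T e g k # data_act G s H f T e (data_sec G H f T e g k) w"

definition data_phi :: "('g, 'b) monoid_scheme \<Rightarrow> nat \<Rightarrow> (nat \<Rightarrow> 'g set) \<Rightarrow> (nat \<Rightarrow> 'g \<Rightarrow> 'g) \<Rightarrow> (nat \<Rightarrow> 'g set)
     \<Rightarrow> (nat \<Rightarrow> nat \<times> 'g) \<Rightarrow> 'g \<Rightarrow> (nat list \<Rightarrow> nat list)" where
  "data_phi G s H f T e g = (\<lambda>w. if w \<in> words (data_m G s H) then data_act G s H f T e g w else w)"

end

theory Submission
  imports Defs
begin

text \<open>
  The data embeds \<open>G\<close> into the finite-state group of some tree, the kernel of the induced action being
  contained in the core. A resetting letter turns this into an action in which every finite subset of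
  \<open>G\<close> is separated by a single word, and a finitely generated abelian group \<open>A\<close> embeds into a
  finite-state group by induction on the number of generators.
  Now let \<open>G\<close> act on words of pairs through the first coordinates. An element \<open>(\<phi>, g)\<close> of \<open>wreath A G\<close> acts on
  \<open>(u, q) $ v\<close>, where \<open>$\<close> ends the pairs, by applying \<open>g\<close> to \<open>u\<close> and the product of all \<open>\<phi> x\<close> with
  \<open>q\<^sup>x = u\<close> to \<open>v\<close>. This is finite-state, since for each of the finitely many \<open>x\<close> with \<open>\<phi> x \<noteq> \<one>\<close> it can be
  checked letter by letter whether \<open>q\<^sup>x = u\<close>; and if \<open>q\<close> separates these \<open>x\<close>, then choosing \<open>u = q\<^sup>x\<close>
  recovers \<open>\<phi> x\<close>.
\<close>

text \<open>No fixed base word can address the lamps: its stabiliser has finite index, so for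
  infinite \<open>G\<close> infinitely many elements agree on it. The query \<open>q\<close> is
  therefore part of the input, and each finite support is resolved by a word of its own. As
  \<open>q\<close> is never moved, matching is equivariant: \<open>q\<^sup>x = u\<close> holds iff
  \<open>q\<close> is sent to \<open>u\<^sup>g\<close> by \<open>x\<close> followed by
  \<open>g\<close>. This is exactly the translation of lamps in \<open>wreath A G\<close>. A short
  query may match several lamps at once; their values are multiplied in no particular order, and
  here commutativity of \<open>A\<close> enters. Faithfulness of \<open>G\<close> alone does not
  provide good queries: two elements that act nontrivially only below two different letters cannot
  both be told from the identity by one word. The resetting letter removes this obstacle.\<close>

section \<open>Tree automorphisms, their states and the finite-state group\<close>

lemma words_Nil [simp]: "[] \<in> words m"
  by (simp add: words_def)

lemma words_Cons [simp]: "i # w \<in> words m \<longleftrightarrow> i < m \<and> w \<in> words m"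
  by (auto simp: words_def)

lemma words_append [simp]: "u @ v \<in> words m \<longleftrightarrow> u \<in> words m \<and> v \<in> words m"
  by (auto simp: words_def)

lemma words_take: "w \<in> words m \<Longrightarrow> take k w \<in> words m"
  using set_take_subset by (fastforce simp: words_def)

lemma words_mono: "w \<in> words k \<Longrightarrow> k \<le> n \<Longrightarrow> w \<in> words n"
  by (auto simp: words_def)

lemma tree_aut_words: "tree_aut m \<alpha> \<Longrightarrow> w \<in> words m \<Longrightarrow> \<alpha> w \<in> words m"
  unfolding tree_aut_def bij_betw_def by blast

lemma tree_aut_outside: "tree_aut m \<alpha> \<Longrightarrow> w \<notin> words m \<Longrightarrow> \<alpha> w = w"
  unfolding tree_aut_def by blast

lemma tree_aut_length: "tree_aut m \<alpha> \<Longrightarrow> length (\<alpha> w) = length w"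
  unfolding tree_aut_def by metis

lemma tree_aut_Nil: "tree_aut m \<alpha> \<Longrightarrow> \<alpha> [] = []"
  using tree_aut_length[of m \<alpha> "[]"] by simp

lemma tree_aut_inject:
  "tree_aut m \<alpha> \<Longrightarrow> u \<in> words m \<Longrightarrow> v \<in> words m \<Longrightarrow> \<alpha> u = \<alpha> v \<longleftrightarrow> u = v"
  unfolding tree_aut_def bij_betw_def inj_on_def by blast

text \<open>Prefix preservation forces the first letter of the image. This recovers the recursion
  behind all inductions on words, with \<open>hd (\<alpha> [i])\<close> in the role of
  \<sigma>(\<alpha>).\<close>

lemma tree_aut_Cons:
  assumes "tree_aut m \<alpha>" "i < m" "w \<in> words m"
  shows "\<alpha> (i # w) = hd (\<alpha> [i]) # state m \<alpha> i w"
proof -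
  have w: "i # w \<in> words m" using assms by simp
  have "take 1 (\<alpha> (i # w)) = \<alpha> (take 1 (i # w))"
    using assms(1) w unfolding tree_aut_def by metis
  hence "take 1 (\<alpha> (i # w)) = \<alpha> [i]" by simp
  moreover obtain a v where av: "\<alpha> (i # w) = a # v"
    using tree_aut_length[OF assms(1), of "i # w"] by (cases "\<alpha> (i # w)") auto
  ultimately have "hd (\<alpha> [i]) = a" by (metis One_nat_def list.sel(1) take_Suc_Cons)
  thus ?thesis using av assms(3) by (simp add: state_def)
qed

lemma tree_aut_single:
  assumes "tree_aut m \<alpha>" "i < m"
  shows "\<alpha> [i] = [hd (\<alpha> [i])]" "hd (\<alpha> [i]) < m"
proof -
  show 1: "\<alpha> [i] = [hd (\<alpha> [i])]"
    using tree_aut_length[OF assms(1), of "[i]"] by (cases "\<alpha> [i]") auto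
  show "hd (\<alpha> [i]) < m"
    using tree_aut_words[OF assms(1), of "[i]"] assms(2) 1 by (metis words_Cons words_Nil)
qed

lemma tree_aut_root_bij:
  assumes "tree_aut m \<alpha>"
  shows "bij_betw (\<lambda>i. hd (\<alpha> [i])) {..<m} {..<m}"
proof -
  have "inj_on (\<lambda>i. hd (\<alpha> [i])) {..<m}"
  proof (rule inj_onI)
    fix i j assume "i \<in> {..<m}" "j \<in> {..<m}" "hd (\<alpha> [i]) = hd (\<alpha> [j])"
    moreover from this have "\<alpha> [i] = \<alpha> [j]"
      using tree_aut_single(1)[OF assms, of i] tree_aut_single(1)[OF assms, of j] by simp
    ultimately show "i = j" using tree_aut_inject[OF assms, of "[i]" "[j]"] by simp
  qed
  moreover have "(\<lambda>i. hd (\<alpha> [i])) ` {..<m} \<subseteq> {..<m}"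
    using tree_aut_single(2)[OF assms] by auto
  ultimately show ?thesis by (simp add: bij_betw_def endo_inj_surj)
qed

lemma tree_aut_state:
  assumes "tree_aut m \<alpha>" "i < m"
  shows "tree_aut m (state m \<alpha> i)"
  unfolding tree_aut_def
proof (intro conjI ballI allI impI)
  note C = tree_aut_Cons[OF assms]
  have cl: "state m \<alpha> i w \<in> words m" if "w \<in> words m" for w
    using tree_aut_words[OF assms(1), of "i # w"] C[OF that] assms(2) that by simp
  have inj: "inj_on (state m \<alpha> i) (words m)"
  proof (rule inj_onI)
    fix u v assume uv: "u \<in> words m" "v \<in> words m" "state m \<alpha> i u = state m \<alpha> i v"
    hence "\<alpha> (i # u) = \<alpha> (i # v)" using C by metis
    thus "u = v" using tree_aut_inject[OF assms(1), of "i # u" "i # v"] uv assms(2) by simp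
  qed
  have "v \<in> state m \<alpha> i ` words m" if v: "v \<in> words m" for v
  proof -
    \<comment> \<open>A preimage of this word must begin with \<open>i\<close>, because the root
      action is injective; its tail is the preimage of \<open>v\<close> under the state.\<close>
    have "hd (\<alpha> [i]) # v \<in> \<alpha> ` words m"
      using assms v tree_aut_single(2)[OF assms] unfolding tree_aut_def bij_betw_def by simp
    then obtain w where w: "w \<in> words m" "\<alpha> w = hd (\<alpha> [i]) # v" by fastforce
    then obtain j w' where jw: "w = j # w'"
      using tree_aut_Nil[OF assms(1)] by (cases w) auto
    have "hd (\<alpha> [j]) = hd (\<alpha> [i])" "state m \<alpha> j w' = v"
      using w jw tree_aut_Cons[OF assms(1), of j w'] by auto
    moreover from this have "j = i"
      using tree_aut_root_bij[OF assms(1)] w jw assms(2) unfolding bij_betw_def inj_on_def by simp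
    ultimately show ?thesis using w jw by auto
  qed
  thus "bij_betw (state m \<alpha> i) (words m) (words m)"
    using inj cl by (auto simp: bij_betw_def)
  fix w
  show "w \<notin> words m \<Longrightarrow> state m \<alpha> i w = w" by (simp add: state_def)
  assume w: "w \<in> words m"
  have "length (\<alpha> (i # w)) = length (i # w)" by (rule tree_aut_length[OF assms(1)])
  thus "length (state m \<alpha> i w) = length w" using C[OF w] by simp
  fix k
  have "\<alpha> (take (Suc k) (i # w)) = take (Suc k) (\<alpha> (i # w))"
    using assms w unfolding tree_aut_def by (metis words_Cons)
  thus "state m \<alpha> i (take k w) = take k (state m \<alpha> i w)"
    using C[OF w] C[OF words_take[OF w]] by simp
qed

lemma state_comp:
  assumes "tree_aut m \<alpha>" "tree_aut m \<beta>" "i < m"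
  shows "state m (\<beta> \<circ> \<alpha>) i = state m \<beta> (hd (\<alpha> [i])) \<circ> state m \<alpha> i"
proof
  fix w
  note s = tree_aut_single(2)[OF assms(1,3)]
  show "state m (\<beta> \<circ> \<alpha>) i w = (state m \<beta> (hd (\<alpha> [i])) \<circ> state m \<alpha> i) w"
  proof (cases "w \<in> words m")
    case True
    have "state m \<alpha> i w \<in> words m"
      using True tree_aut_words[OF tree_aut_state[OF assms(1,3)]] by blast
    hence "\<beta> (\<alpha> (i # w)) = hd (\<beta> [hd (\<alpha> [i])]) # state m \<beta> (hd (\<alpha> [i])) (state m \<alpha> i w)"
      using tree_aut_Cons[OF assms(1,3) True] tree_aut_Cons[OF assms(2) s] by metis
    thus ?thesis using True by (simp add: state_def[of m "\<beta> \<circ> \<alpha>"])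
  qed (simp add: state_def)
qed

lemma hd_comp:
  assumes "tree_aut m \<alpha>" "tree_aut m \<beta>" "i < m"
  shows "hd ((\<beta> \<circ> \<alpha>) [i]) = hd (\<beta> [hd (\<alpha> [i])])"
  using tree_aut_single(1)[OF assms(1,3)] by (metis comp_apply)

abbreviation fs :: "nat \<Rightarrow> (nat list \<Rightarrow> nat list) set" where
  "fs m \<equiv> carrier (fs_group m)"

lemma fs_iff: "\<alpha> \<in> fs m \<longleftrightarrow> tree_aut m \<alpha> \<and> finite_state m \<alpha>"
  by (simp add: fs_group_def)

lemma fs_tree_aut: "\<alpha> \<in> fs m \<Longrightarrow> tree_aut m \<alpha>"
  by (simp add: fs_iff)

lemma fs_mult [simp]: "\<alpha> \<otimes>\<^bsub>fs_group m\<^esub> \<beta> = \<beta> \<circ> \<alpha>"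
  by (simp add: fs_group_def)

lemma Qset_state_subset:
  assumes "\<beta> \<in> Qset m \<alpha>" shows "Qset m \<beta> \<subseteq> Qset m \<alpha>"
proof
  fix \<gamma> assume "\<gamma> \<in> Qset m \<beta>"
  thus "\<gamma> \<in> Qset m \<alpha>" by induct (auto intro: assms Qset.step)
qed

lemma Qset_fs:
  assumes "\<alpha> \<in> fs m" "\<beta> \<in> Qset m \<alpha>" shows "\<beta> \<in> fs m"
proof -
  have "tree_aut m \<beta>" using assms(2)
    by induct (use assms(1) tree_aut_state fs_tree_aut in auto)
  moreover have "finite (Qset m \<beta>)"
    using finite_subset[OF Qset_state_subset[OF assms(2)]] assms(1) by (simp add: fs_iff finite_state_def)
  ultimately show ?thesis by (simp add: fs_iff finite_state_def)
qed

section \<open>Automorphisms defined by machines\<close>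

primrec run :: "('s \<Rightarrow> nat \<Rightarrow> nat) \<Rightarrow> ('s \<Rightarrow> nat \<Rightarrow> 's) \<Rightarrow> 's \<Rightarrow> nat list \<Rightarrow> nat list" where
  "run \<sigma> \<delta> q [] = []"
| "run \<sigma> \<delta> q (j # w) = \<sigma> q j # run \<sigma> \<delta> (\<delta> q j) w"

definition machine ::
  "nat \<Rightarrow> ('s \<Rightarrow> nat \<Rightarrow> nat) \<Rightarrow> ('s \<Rightarrow> nat \<Rightarrow> 's) \<Rightarrow> 's \<Rightarrow> nat list \<Rightarrow> nat list" where
  "machine n \<sigma> \<delta> q = (\<lambda>w. if w \<in> words n then run \<sigma> \<delta> q w else w)"

text \<open>The type of states may be infinite (integers, group elements, functions).
  \<open>S\<close> is a part of it closed under transitions; finite-stateness amounts to a finite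
  such \<open>S\<close> around one initial state.\<close>

definition invertible :: "nat \<Rightarrow> ('s \<Rightarrow> nat \<Rightarrow> nat) \<Rightarrow> ('s \<Rightarrow> nat \<Rightarrow> 's) \<Rightarrow> 's set \<Rightarrow> bool" where
  "invertible n \<sigma> \<delta> S \<longleftrightarrow>
     (\<forall>q\<in>S. bij_betw (\<sigma> q) {..<n} {..<n} \<and> (\<forall>j<n. \<delta> q j \<in> S))"

lemma length_run [simp]: "length (run \<sigma> \<delta> q w) = length w"
  by (induct w arbitrary: q) auto

lemma run_take: "run \<sigma> \<delta> q (take k w) = take k (run \<sigma> \<delta> q w)"
  by (induct w arbitrary: q k) (auto simp: take_Cons')

lemma run_bij:
  assumes "invertible n \<sigma> \<delta> S" "q \<in> S"
  shows "bij_betw (run \<sigma> \<delta> q) (words n) (words n)"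
proof -
  have cl: "run \<sigma> \<delta> q w \<in> words n" if "w \<in> words n" "q \<in> S" for q w
    using that
  proof (induct w arbitrary: q)
    case (Cons j w)
    thus ?case using assms(1) by (auto simp: invertible_def bij_betw_def)
  qed simp
  have inj: "u = v" if "u \<in> words n" "v \<in> words n" "run \<sigma> \<delta> q u = run \<sigma> \<delta> q v" "q \<in> S" for q u v
    using that
  proof (induct u arbitrary: q v)
    case Nil thus ?case by (cases v) auto
  next
    case (Cons j u)
    then obtain i v' where v: "v = i # v'" by (cases v) auto
    have "i = j" using Cons assms(1) v by (auto simp: invertible_def bij_betw_def inj_on_def)
    thus ?case using Cons assms(1) v by (auto simp: invertible_def)
  qed
  have surj: "\<exists>w\<in>words n. run \<sigma> \<delta> q w = v" if "v \<in> words n" "q \<in> S" for q v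
    using that
  proof (induct v arbitrary: q)
    case (Cons i v)
    hence "i \<in> \<sigma> q ` {..<n}" using assms(1) unfolding invertible_def bij_betw_def by simp
    then obtain j where j: "j < n" "\<sigma> q j = i" by blast
    moreover have "\<delta> q j \<in> S" "v \<in> words n" using Cons assms(1) j by (auto simp: invertible_def)
    ultimately obtain w where "w \<in> words n" "run \<sigma> \<delta> (\<delta> q j) w = v"
      using Cons(1) by blast
    thus ?case using j by (intro bexI[of _ "j # w"]) auto
  qed (auto intro: bexI[of _ "[]"])
  have "run \<sigma> \<delta> q ` words n = words n" using cl[OF _ assms(2)] surj[OF _ assms(2)] by blast
  thus ?thesis unfolding bij_betw_def inj_on_def using inj assms(2) by blast
qed

lemma machine_tree_aut:
  assumes "invertible n \<sigma> \<delta> S" "q \<in> S"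
  shows "tree_aut n (machine n \<sigma> \<delta> q)"
  using run_bij[OF assms] bij_betw_cong[of "words n" "machine n \<sigma> \<delta> q" "run \<sigma> \<delta> q"]
  by (simp add: tree_aut_def machine_def run_take words_take)

lemma state_machine: "j < n \<Longrightarrow> state n (machine n \<sigma> \<delta> q) j = machine n \<sigma> \<delta> (\<delta> q j)"
  by (auto simp: state_def machine_def)

lemma machine_fs:
  assumes "invertible n \<sigma> \<delta> S" "finite S" "q \<in> S"
  shows "machine n \<sigma> \<delta> q \<in> fs n"
proof -
  have "\<beta> \<in> machine n \<sigma> \<delta> ` S" if "\<beta> \<in> Qset n (machine n \<sigma> \<delta> q)" for \<beta>
    using that
  proof induct
    case base thus ?case using assms(3) by blast
  next
    case (step \<beta> i)
    thus ?case using assms(1) state_machine[of i n \<sigma> \<delta>] by (auto simp: invertible_def)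
  qed
  hence "finite_state n (machine n \<sigma> \<delta> q)"
    unfolding finite_state_def by (intro finite_subset[OF subsetI finite_imageI[OF assms(2)]])
  thus ?thesis using machine_tree_aut[OF assms(1,3)] by (simp add: fs_iff)
qed

text \<open>\<open>R\<close> is a bisimulation between running \<open>q1\<close> then
  \<open>q2\<close> and running \<open>q\<close>, so a product is verified one letter at a
  time.\<close>

lemma machine_comp:
  assumes R: "R q1 q2 q"
    and step: "\<And>q1 q2 q j. R q1 q2 q \<Longrightarrow> j < n \<Longrightarrow>
      \<sigma> q1 j < n \<and> \<sigma> q j = \<sigma> q2 (\<sigma> q1 j) \<and> R (\<delta> q1 j) (\<delta> q2 (\<sigma> q1 j)) (\<delta> q j)"
  shows "machine n \<sigma> \<delta> q = machine n \<sigma> \<delta> q2 \<circ> machine n \<sigma> \<delta> q1"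
proof -
  have cl: "run \<sigma> \<delta> q1 w \<in> words n" if "w \<in> words n" "R q1 q2 q" for q1 q2 q w
    using that
  proof (induct w arbitrary: q1 q2 q)
    case (Cons j w)
    thus ?case using step[OF Cons(3), of j] by auto
  qed simp
  have "run \<sigma> \<delta> q w = run \<sigma> \<delta> q2 (run \<sigma> \<delta> q1 w)" if "w \<in> words n" "R q1 q2 q" for q1 q2 q w
    using that
  proof (induct w arbitrary: q1 q2 q)
    case (Cons j w)
    thus ?case using step[OF Cons(3), of j] by auto
  qed simp
  thus ?thesis using cl R by (auto simp: machine_def fun_eq_iff)
qed

text \<open>Through \<open>I\<close> (later \<open>Inr\<close>) given tree automorphisms serve as
  states of a machine, which then acts by them.\<close>

lemma run_eq_aut:
  assumes "\<And>b j. \<sigma> (I b) j = hd (b [j])" "\<And>b j. \<delta> (I b) j = I (state n b j)"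
    and "tree_aut n b" "w \<in> words n"
  shows "run \<sigma> \<delta> (I b) w = b w"
  using assms(3,4)
proof (induct w arbitrary: b)
  case Nil thus ?case by (simp add: tree_aut_Nil)
next
  case (Cons j w)
  thus ?case using tree_aut_Cons[of n b j w] by (auto simp: assms tree_aut_state)
qed

lemma fs_id: "id \<in> fs n"
proof -
  let ?\<delta> = "\<lambda>_ _. ()" and ?\<sigma> = "\<lambda>_::unit. id :: nat \<Rightarrow> nat"
  have "run ?\<sigma> ?\<delta> q w = w" for q w by (induct w arbitrary: q) auto
  hence "machine n ?\<sigma> ?\<delta> () = id" by (auto simp: machine_def)
  moreover have "machine n ?\<sigma> ?\<delta> () \<in> fs n"
    by (rule machine_fs[of _ _ _ UNIV]) (auto simp: invertible_def)
  ultimately show ?thesis by simp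
qed


section \<open>Enlarging the alphabet and one-level wreath recursions\<close>

definition fs_embeddable :: "('a, 'b) monoid_scheme \<Rightarrow> nat \<Rightarrow> bool" where
  "fs_embeddable G n \<longleftrightarrow> (\<exists>h. h \<in> hom G (fs_group n) \<and> inj_on h (carrier G))"

lemma bij_betw_pad:
  fixes k n :: nat
  assumes "bij_betw f {..<k} {..<k}" "k \<le> n"
  shows "bij_betw (\<lambda>j. if j < k then f j else j) {..<n} {..<n}"
proof -
  have "bij_betw (\<lambda>j. if j \<in> {..<k} then f j else j) ({..<k} \<union> {k..<n}) ({..<k} \<union> {k..<n})"
    by (rule bij_betw_disjoint_Un) (use assms in \<open>auto simp: bij_betw_def inj_on_def\<close>)
  moreover have "{..<k} \<union> {k..<n} = {..<n}" using assms(2) by auto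
  ultimately show ?thesis by simp
qed

text \<open>New letters are fixed and leave the state as it is; words over the old letters still
  show the old action, whence injectivity.\<close>

lemma fs_group_mono:
  assumes "k \<le> n"
  shows "fs_embeddable (fs_group k) n"
proof -
  define \<sigma> where "\<sigma> b j = (if j < k then hd (b [j]) else j)" for b :: "nat list \<Rightarrow> nat list" and j
  define \<delta> where "\<delta> b j = (if j < k then state k b j else b)" for b j
  let ?h = "machine n \<sigma> \<delta>"
  have fin: "?h b \<in> fs n" if b: "b \<in> fs k" for b
  proof (rule machine_fs[where S = "Qset k b"])
    show "finite (Qset k b)" using b by (simp add: fs_iff finite_state_def)
    show "invertible n \<sigma> \<delta> (Qset k b)"
      using bij_betw_pad[OF tree_aut_root_bij assms] Qset_fs[OF b] fs_tree_aut
      by (auto simp: invertible_def \<sigma>_def[abs_def] \<delta>_def intro: Qset.step)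
  qed (rule Qset.base)
  have mult: "?h (b \<circ> a) = ?h b \<circ> ?h a" if "a \<in> fs k" "b \<in> fs k" for a b
  proof (rule machine_comp[where R = "\<lambda>a b c. tree_aut k a \<and> tree_aut k b \<and> c = b \<circ> a"])
    fix a b c j assume "tree_aut k a \<and> tree_aut k b \<and> c = b \<circ> a" "j < n"
    thus "\<sigma> a j < n \<and> \<sigma> c j = \<sigma> b (\<sigma> a j) \<and>
        tree_aut k (\<delta> a j) \<and> tree_aut k (\<delta> b (\<sigma> a j)) \<and> \<delta> c j = \<delta> b (\<sigma> a j) \<circ> \<delta> a j"
      using assms tree_aut_single(2)[of k a j] hd_comp[of k a b j] state_comp[of k a b j]
      by (auto simp: \<sigma>_def \<delta>_def tree_aut_state)
  qed (use that fs_tree_aut in auto)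
  have run: "run \<sigma> \<delta> b w = b w" if "w \<in> words k" "tree_aut k b" for b w
    using that
  proof (induct w arbitrary: b)
    case Nil thus ?case by (simp add: tree_aut_Nil)
  next
    case (Cons j w)
    thus ?case using tree_aut_Cons[of k b j w] by (auto simp: \<sigma>_def \<delta>_def tree_aut_state)
  qed
  have "inj_on ?h (fs k)"
  proof (rule inj_onI, rule ext)
    fix a b w assume ab: "a \<in> fs k" "b \<in> fs k" "?h a = ?h b"
    show "a w = b w"
    proof (cases "w \<in> words k")
      case True
      hence "?h a w = a w" "?h b w = b w"
        using ab(1,2) by (simp_all add: machine_def run fs_tree_aut words_mono[OF True assms] True)
      thus ?thesis using ab(3) by simp
    next
      case False
      thus ?thesis using ab(1,2) fs_tree_aut tree_aut_outside by metis
    qed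
  qed
  thus ?thesis unfolding fs_embeddable_def using fin mult by (intro exI[of _ ?h]) (auto simp: hom_def)
qed

lemma fs_embeddable_mono:
  assumes "fs_embeddable G k" "k \<le> n"
  shows "fs_embeddable G n"
proof -
  obtain h where h: "h \<in> hom G (fs_group k)" "inj_on h (carrier G)"
    using assms(1) by (auto simp: fs_embeddable_def)
  obtain i where i: "i \<in> hom (fs_group k) (fs_group n)" "inj_on i (fs k)"
    using fs_group_mono[OF assms(2)] by (auto simp: fs_embeddable_def)
  have "h ` carrier G \<subseteq> fs k" using h(1) by (auto simp: hom_def)
  hence "inj_on (i \<circ> h) (carrier G)" using h(2) i(2) by (metis comp_inj_on inj_on_subset)
  moreover have "i \<circ> h \<in> hom G (fs_group n)" by (rule hom_compose[OF h(1) i(1)])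
  ultimately show ?thesis by (auto simp: fs_embeddable_def)
qed

text \<open>The tree automorphism with root action \<open>s g\<close> and states
  \<open>d g j\<close>. The element \<open>g\<close> is a state at the root only; below it the
  machine runs in automorphisms \<open>Inr b\<close>.\<close>

definition root_wreath ::
  "nat \<Rightarrow> ('g \<Rightarrow> nat \<Rightarrow> nat) \<Rightarrow> ('g \<Rightarrow> nat \<Rightarrow> nat list \<Rightarrow> nat list) \<Rightarrow> 'g \<Rightarrow> nat list \<Rightarrow> nat list" where
  "root_wreath n s d g = machine n
     (\<lambda>q j. case q of Inl g \<Rightarrow> s g j | Inr b \<Rightarrow> hd (b [j]))
     (\<lambda>q j. case q of Inl g \<Rightarrow> Inr (d g j) | Inr b \<Rightarrow> Inr (state n b j)) (Inl g)"

text \<open>\<open>mult\<close> is the product rule of the permutational wreath product, and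
  finitely many finite-state automorphisms \<open>d g j\<close> below one root state give a
  finite-state automorphism.\<close>

lemma root_wreath_hom:
  assumes "group G"
    and cl: "\<And>g j. g \<in> carrier G \<Longrightarrow> j < n \<Longrightarrow> s g j < n \<and> d g j \<in> fs n"
    and one: "\<And>j. j < n \<Longrightarrow> s \<one>\<^bsub>G\<^esub> j = j"
    and mult: "\<And>g h j. g \<in> carrier G \<Longrightarrow> h \<in> carrier G \<Longrightarrow> j < n \<Longrightarrow>
      s (g \<otimes>\<^bsub>G\<^esub> h) j = s h (s g j) \<and> d (g \<otimes>\<^bsub>G\<^esub> h) j = d h (s g j) \<circ> d g j"
  shows "root_wreath n s d \<in> hom G (fs_group n)"
proof (rule homI)
  interpret group G by fact
  let ?\<sigma> = "\<lambda>q j. case q of Inl g \<Rightarrow> s g j | Inr b \<Rightarrow> hd (b [j])"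
  let ?\<delta> = "\<lambda>q j. case q of Inl g \<Rightarrow> Inr (d g j) | Inr b \<Rightarrow> Inr (state n b j)"
  fix g assume g: "g \<in> carrier G"
  have bij: "bij_betw (s g) {..<n} {..<n}"
  \<comment> \<open>\<open>one\<close> and \<open>mult\<close>, applied to \<open>g\<close> and its
    inverse, make \<open>s g\<close> a permutation.\<close>
  proof (rule bij_betw_byWitness[where f' = "s (inv\<^bsub>G\<^esub> g)"])
    show "\<forall>j\<in>{..<n}. s (inv\<^bsub>G\<^esub> g) (s g j) = j" "\<forall>j\<in>{..<n}. s g (s (inv\<^bsub>G\<^esub> g) j) = j"
      using mult[of g "inv\<^bsub>G\<^esub> g"] mult[of "inv\<^bsub>G\<^esub> g" g] g one by auto
  qed (use cl g in auto)
  let ?D = "\<Union>j<n. Qset n (d g j)"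
  show "root_wreath n s d g \<in> carrier (fs_group n)"
    unfolding root_wreath_def
  proof (rule machine_fs[where S = "insert (Inl g) (Inr ` ?D)"])
    have "finite (Qset n (d g j))" if "j < n" for j
      using cl[OF g that] by (simp add: fs_iff finite_state_def)
    thus "finite (insert (Inl g) (Inr ` ?D))" by auto
    have "tree_aut n b" if "b \<in> ?D" for b using that Qset_fs cl[OF g] fs_tree_aut by blast
    moreover have "d g j \<in> ?D" if "j < n" for j using that Qset.base by blast
    moreover have "state n b j \<in> ?D" if "b \<in> ?D" "j < n" for b j using that Qset.step by blast
    ultimately show "invertible n ?\<sigma> ?\<delta> (insert (Inl g) (Inr ` ?D))"
      using bij tree_aut_root_bij by (auto simp: invertible_def image_iff)
  qed simp
  fix h assume h: "h \<in> carrier G"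
  define R where "R p q r \<longleftrightarrow>
      (\<exists>g h. p = Inl g \<and> q = Inl h \<and> r = Inl (g \<otimes>\<^bsub>G\<^esub> h) \<and> g \<in> carrier G \<and> h \<in> carrier G)
    \<or> (\<exists>b c. p = Inr b \<and> q = Inr c \<and> r = Inr (c \<circ> b) \<and> tree_aut n b \<and> tree_aut n c)" for p q r
  have "root_wreath n s d (g \<otimes>\<^bsub>G\<^esub> h) = root_wreath n s d h \<circ> root_wreath n s d g"
    unfolding root_wreath_def
  proof (rule machine_comp[where R = R])
    show "R (Inl g) (Inl h) (Inl (g \<otimes>\<^bsub>G\<^esub> h))" using g h by (auto simp: R_def)
    fix p q r j assume "R p q r" and j: "j < n"
    then consider g h where "p = Inl g" "q = Inl h" "r = Inl (g \<otimes>\<^bsub>G\<^esub> h)" "g \<in> carrier G" "h \<in> carrier G"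
      | b c where "p = Inr b" "q = Inr c" "r = Inr (c \<circ> b)" "tree_aut n b" "tree_aut n c"
      unfolding R_def by blast
    thus "?\<sigma> p j < n \<and> ?\<sigma> r j = ?\<sigma> q (?\<sigma> p j) \<and> R (?\<delta> p j) (?\<delta> q (?\<sigma> p j)) (?\<delta> r j)"
    proof cases
      case 1
      thus ?thesis using mult[OF 1(4,5) j] cl[OF 1(4) j] cl[OF 1(5)] fs_tree_aut
        by (auto simp: R_def)
    next
      case 2
      have "hd (b [j]) < n" by (rule tree_aut_single(2)[OF 2(4) j])
      thus ?thesis using 2 hd_comp[OF 2(4,5) j] state_comp[OF 2(4,5) j] j tree_aut_state
        by (simp add: R_def)
    qed
  qed
  thus "root_wreath n s d (g \<otimes>\<^bsub>G\<^esub> h) = root_wreath n s d g \<otimes>\<^bsub>fs_group n\<^esub> root_wreath n s d h"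
    by simp
qed

lemma root_wreath_eqD:
  assumes "root_wreath n s d g = root_wreath n s d h" "j < n" "d g j \<in> fs n" "d h j \<in> fs n"
  shows "s g j = s h j" "d g j = d h j"
proof -
  have ev: "root_wreath n s d g (j # w) = s g j # d g j w"
    if "w \<in> words n" "d g j \<in> fs n" for w g
    unfolding root_wreath_def machine_def
    using that assms(2) by (simp add: fs_tree_aut run_eq_aut[where I = Inr])
  show "s g j = s h j" using ev[of "[]" g] ev[of "[]" h] assms by simp
  have "d g j w = d h j w" if "w \<in> words n" for w
    using ev[OF that, of g] ev[OF that, of h] assms by simp
  moreover have "d g j w = d h j w" if "w \<notin> words n" for w
    using that assms(3,4) fs_tree_aut tree_aut_outside by metis
  ultimately show "d g j = d h j" by blast
qed

section \<open>Finitely generated abelian groups\<close>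

text \<open>The binary adding machine, least significant digit first: \<open>z i\<close> adds
  \<open>i\<close>, the state is the carry, and letters from 2 on are skipped.\<close>

lemma odometer:
  assumes "2 \<le> n"
  obtains z :: "int \<Rightarrow> nat list \<Rightarrow> nat list"
  where "\<And>i. z i \<in> fs n" "\<And>i j. z (i + j) = z j \<circ> z i" "inj z"
proof -
  define \<sigma> where "\<sigma> i j = (if j < 2 then nat ((i + int j) mod 2) else j)" for i :: int and j :: nat
  define \<delta> where "\<delta> i j = (if j < 2 then (i + int j) div 2 else i)" for i :: int and j :: nat
  let ?z = "machine n \<sigma> \<delta>"
  have bij: "bij_betw (\<sigma> i) {..<n} {..<n}" for i
  proof -
    have "bij_betw (\<lambda>j. nat ((i + int j) mod 2)) {..<2} {..<2}"
    proof (rule bij_betw_byWitness[where f' = "\<lambda>j. nat ((int j - i) mod 2)"])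
      show "\<forall>j\<in>{..<2}. nat ((int (nat ((i + int j) mod 2)) - i) mod 2) = j"
        by (auto simp: mod_diff_left_eq nat_mod_as_int)
      show "\<forall>j\<in>{..<2}. nat ((i + int (nat ((int j - i) mod 2))) mod 2) = j"
        by (auto simp: mod_add_right_eq)
    qed auto
    from bij_betw_pad[OF this assms] show ?thesis by (simp add: \<sigma>_def[abs_def])
  qed
  have "?z i \<in> fs n" for i
  \<comment> \<open>Adding a digit 0 or 1 and halving never increases the absolute value bound of
    the carry.\<close>
  proof (rule machine_fs[where S = "{- \<bar>i\<bar>..\<bar>i\<bar>}"])
    show "invertible n \<sigma> \<delta> {- \<bar>i\<bar>..\<bar>i\<bar>}"
      using bij by (auto simp: invertible_def \<delta>_def)
  qed auto
  moreover have "?z (i + j) = ?z j \<circ> ?z i" for i j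
  proof (rule machine_comp[where R = "\<lambda>i j k. k = i + j"])
    fix i j k :: int and d assume "k = i + j" "d < n"
    moreover have "(i + j + d) div 2 = (i + d) div 2 + (j + (i + d) mod 2) div 2"
      "(i + j + d) mod 2 = (j + (i + d) mod 2) mod 2" for d :: int by presburger+
    moreover have "nat ((i + int d) mod 2) < 2" by simp
    ultimately show "\<sigma> i d < n \<and> \<sigma> k d = \<sigma> j (\<sigma> i d) \<and> \<delta> k d = \<delta> i d + \<delta> j (\<sigma> i d)"
      using assms by (auto simp: \<sigma>_def \<delta>_def)
  qed simp
  moreover have "i = j" if "?z i = ?z j" for i j
    using that
  \<comment> \<open>On words beginning with 0, equal outputs give equal parities and equal actions
    of the halves, so the difference is halved.\<close>
  proof (induct "nat \<bar>i - j\<bar>" arbitrary: i j rule: less_induct)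
    case (less i j)
    have run: "run \<sigma> \<delta> i w = run \<sigma> \<delta> j w" if "w \<in> words n" for w
      using fun_cong[OF less(2), of w] that by (simp add: machine_def)
    have "run \<sigma> \<delta> (\<delta> i 0) w = run \<sigma> \<delta> (\<delta> j 0) w" if "w \<in> words n" for w
      using run[of "0 # w"] that assms by simp
    hence "?z (i div 2) = ?z (j div 2)" by (auto simp: machine_def \<delta>_def)
    moreover have par: "i mod 2 = j mod 2" using run[of "[0]"] assms by (simp add: \<sigma>_def)
    moreover have "nat \<bar>i div 2 - j div 2\<bar> < nat \<bar>i - j\<bar>" if "i \<noteq> j"
    proof -
      have "i - j = 2 * (i div 2 - j div 2)" using par by presburger
      thus ?thesis using that by simp
    qed
    ultimately have "i \<noteq> j \<Longrightarrow> i div 2 = j div 2" using less(1) by blast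
    thus "i = j" using par by presburger
  qed
  ultimately show thesis using that[of ?z] by (auto simp: inj_def)
qed

text \<open>\<open>V\<close> collects exponents whose powers of \<open>x\<close> lie in distinct
  cosets of \<open>B\<close>. It will be \<open>{0..<r}\<close> for \<open>x\<close> of finite order
  \<open>r\<close> modulo \<open>B\<close>, and all integers otherwise.\<close>

lemma (in comm_group) cyclic_extension_normal_form:
  assumes B: "subgroup B G" and x: "x \<in> carrier G"
    and uniq: "\<And>i j. i \<in> V \<Longrightarrow> j \<in> V \<Longrightarrow> x [^] (i - j :: int) \<in> B \<Longrightarrow> i = j"
    and ex: "\<And>c. c \<in> C \<Longrightarrow> \<exists>b\<in>B. \<exists>i\<in>V. c = b \<otimes> x [^] i"
  obtains idx cof where
    "\<And>c. c \<in> C \<Longrightarrow> idx c \<in> V \<and> cof c \<in> B \<and> c = cof c \<otimes> x [^] idx c"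
    "\<And>b i. b \<in> B \<Longrightarrow> i \<in> V \<Longrightarrow> idx (b \<otimes> x [^] i) = i \<and> cof (b \<otimes> x [^] i) = b"
proof -
  define dec where "dec c = (SOME bi. fst bi \<in> B \<and> snd bi \<in> V \<and> c = fst bi \<otimes> x [^] snd bi)" for c
  have dec: "fst (dec c) \<in> B \<and> snd (dec c) \<in> V \<and> c = fst (dec c) \<otimes> x [^] snd (dec c)"
    if "\<exists>b\<in>B. \<exists>i\<in>V. c = b \<otimes> x [^] i" for c
    unfolding dec_def by (rule someI_ex) (use that in auto)
  have "dec (b \<otimes> x [^] i) = (b, i)" if bi: "b \<in> B" "i \<in> V" for b i
  proof -
    obtain b' i' where d: "dec (b \<otimes> x [^] i) = (b', i')" by fastforce
    have b': "b' \<in> B" "i' \<in> V" "b \<otimes> x [^] i = b' \<otimes> x [^] i'"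
      using dec[of "b \<otimes> x [^] i"] bi d by auto
    have car: "b \<in> carrier G" "b' \<in> carrier G" using bi b' subgroup.subset[OF B] by auto
    have "x [^] (i - i') = x [^] i \<otimes> inv (x [^] i')" using int_pow_diff[OF x] by simp
    also have "\<dots> = inv b \<otimes> b'"
      using b'(3) car x by (metis int_pow_closed inv_closed inv_solve_left inv_solve_right' m_assoc m_closed)
    finally have "x [^] (i - i') \<in> B"
      using bi b' B by (simp add: subgroup.m_closed subgroup.m_inv_closed)
    hence "i = i'" using uniq bi b' by blast
    moreover from this have "b = b'" using b'(3) car x by simp
    ultimately show ?thesis using d by simp
  qed
  thus thesis using dec ex by (intro that[of "\<lambda>c. snd (dec c)" "\<lambda>c. fst (dec c)"]) auto
qed

text \<open>If \<open>x\<close> has finite order modulo \<open>B\<close>, then \<open>C\<close> need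
  not split over \<open>B\<close>; it embeds by its action on the cosets of \<open>B\<close> (the
  Kaloujnine-Krasner embedding). Otherwise \<open>C\<close> is the direct product of
  \<open>B\<close> and an infinite cyclic group.\<close>

lemma (in comm_group) fs_embeddable_cyclic_extension:
  assumes B: "subgroup B G" and x: "x \<in> carrier G" and C: "subgroup C G"
    and C_eq: "C = {b \<otimes> x [^] (i::int) | b i. b \<in> B}"
    and emb: "fs_embeddable (G\<lparr>carrier := B\<rparr>) k"
  shows "\<exists>n. fs_embeddable (G\<lparr>carrier := C\<rparr>) n"
proof -
  let ?C = "G\<lparr>carrier := C\<rparr>"
  have grp: "group ?C" by (rule subgroup.subgroup_is_group[OF C group_axioms])
  have Bc: "b \<in> carrier G" if "b \<in> B" for b using that subgroup.subset[OF B] by blast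
  have Cc: "c \<in> carrier G" if "c \<in> C" for c using that subgroup.subset[OF C] by blast
  have pow: "x [^] (i + j :: int) = x [^] i \<otimes> x [^] j" for i j by (rule int_pow_mult[OF x])
  have powC: "x [^] (i :: int) \<in> C" for i
    unfolding C_eq using subgroup.one_closed[OF B] x by (auto intro!: exI[of _ "\<one>"])
  note Bm = subgroup.m_closed[OF B] and Cm = subgroup.m_closed[OF C]
  show ?thesis
  proof (cases "\<exists>r::nat. r > 0 \<and> x [^] (int r) \<in> B")
    case True
    define r where "r = (LEAST r::nat. r > 0 \<and> x [^] (int r) \<in> B)"
    have r: "r > 0" "x [^] (int r) \<in> B" using LeastI_ex[OF True] unfolding r_def by auto
    have rmin: "r \<le> i" if "i > 0" "x [^] (int i) \<in> B" for i
      unfolding r_def using that by (intro Least_le) auto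
    define V where "V = {0..<int r}"
    have uniq: "i = j" if ij: "i \<in> V" "j \<in> V" "x [^] (i - j :: int) \<in> B" for i j
    proof (rule ccontr)
      assume "i \<noteq> j"
      have "x [^] (int (nat \<bar>i - j\<bar>)) \<in> B"
      proof (cases "i - j \<ge> 0")
        case False
        have "x [^] (- (i - j)) = inv (x [^] (i - j))" using x by (rule int_pow_neg)
        thus ?thesis using False ij(3) subgroup.m_inv_closed[OF B ij(3)] by simp
      qed (use ij in simp)
      hence "r \<le> nat \<bar>i - j\<bar>" using rmin[of "nat \<bar>i - j\<bar>"] \<open>i \<noteq> j\<close> by simp
      thus False using ij unfolding V_def by auto
    qed
    have ex: "\<exists>b\<in>B. \<exists>i\<in>V. c = b \<otimes> x [^] i" if c: "c \<in> C" for c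
    proof -
      obtain b i where bi: "c = b \<otimes> x [^] (i::int)" "b \<in> B" using c C_eq by auto
      have "x [^] (int r * (i div int r)) = (x [^] int r) [^] (i div int r)"
        using int_pow_pow[OF x, of "int r"] by simp
      also have "\<dots> \<in> B" using r(2) B by (simp add: subgroup_int_pow_closed)
      finally have "b \<otimes> x [^] (int r * (i div int r)) \<in> B" using bi Bm by blast
      moreover have "c = b \<otimes> x [^] (int r * (i div int r)) \<otimes> x [^] (i mod int r)"
        using bi Bc x pow[of "int r * (i div int r)" "i mod int r"] by (simp add: m_assoc)
      moreover have "i mod int r \<in> V" using r by (simp add: V_def)
      ultimately show ?thesis by blast
    qed
    obtain idx cof where dec: "\<And>c. c \<in> C \<Longrightarrow> idx c \<in> V \<and> cof c \<in> B \<and> c = cof c \<otimes> x [^] idx c"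
      and dec': "\<And>b i. b \<in> B \<Longrightarrow> i \<in> V \<Longrightarrow> idx (b \<otimes> x [^] i) = i \<and> cof (b \<otimes> x [^] i) = b"
      using cyclic_extension_normal_form[OF B x uniq ex] by blast
    define n where "n = max r k"
    have "fs_embeddable (G\<lparr>carrier := B\<rparr>) n" by (rule fs_embeddable_mono[OF emb]) (simp add: n_def)
    then obtain h where h: "\<And>a. a \<in> B \<Longrightarrow> h a \<in> fs n"
      "\<And>a b. a \<in> B \<Longrightarrow> b \<in> B \<Longrightarrow> h (a \<otimes> b) = h b \<circ> h a" "inj_on h B"
      unfolding fs_embeddable_def hom_def by auto
    \<comment> \<open>Letter \<open>j < r\<close> stands for the coset of \<open>x [^] j\<close>.
      Multiplying this representative by \<open>a\<close> and taking the normal form gives the new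
      letter and, from the \<open>B\<close>-part, the state.\<close>
    define s where "s a j = (if j < r then nat (idx (x [^] (int j) \<otimes> a)) else j)" for a j
    define d where "d a j = (if j < r then h (cof (x [^] (int j) \<otimes> a)) else id)" for a j
    have cl: "s a j < n \<and> d a j \<in> fs n" if "a \<in> C" "j < n" for a j
    proof -
      have "idx (x [^] (int j) \<otimes> a) \<in> V" "cof (x [^] (int j) \<otimes> a) \<in> B"
        using dec[OF Cm[OF powC that(1)]] by blast+
      thus ?thesis using that h(1) fs_id by (auto simp: s_def d_def V_def n_def)
    qed
    have "root_wreath n s d \<in> hom ?C (fs_group n)"
    proof (rule root_wreath_hom[OF grp])
      show "s \<one>\<^bsub>?C\<^esub> j = j" for j
        using dec'[OF subgroup.one_closed[OF B], of "int j"] x by (simp add: s_def V_def)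
      fix a b j assume "a \<in> carrier ?C" "b \<in> carrier ?C"
      hence ab: "a \<in> C" "b \<in> C" by auto
      have "s (a \<otimes> b) j = s b (s a j) \<and> d (a \<otimes> b) j = d b (s a j) \<circ> d a j" if j: "j < r"
      proof -
        let ?u = "x [^] (int j) \<otimes> a"
        define b1 i1 where "b1 = cof ?u" "i1 = idx ?u"
        have 1: "i1 \<in> V" "b1 \<in> B" "?u = b1 \<otimes> x [^] i1"
          using dec[OF Cm[OF powC ab(1)]] unfolding b1_i1_def by auto
        define b2 i2 where "b2 = cof (x [^] i1 \<otimes> b)" "i2 = idx (x [^] i1 \<otimes> b)"
        have 2: "i2 \<in> V" "b2 \<in> B" "x [^] i1 \<otimes> b = b2 \<otimes> x [^] i2"
          using dec[OF Cm[OF powC ab(2)]] unfolding b2_i2_def by auto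
        have "x [^] (int j) \<otimes> (a \<otimes> b) = b1 \<otimes> (x [^] i1 \<otimes> b)"
          using 1(3) ab x Cc Bc 1(2) by (metis int_pow_closed m_assoc)
        also have "\<dots> = (b1 \<otimes> b2) \<otimes> x [^] i2"
          using 2(3) x Bc[OF 1(2)] Bc[OF 2(2)] by (simp add: m_assoc)
        finally have "idx (x [^] (int j) \<otimes> (a \<otimes> b)) = i2" "cof (x [^] (int j) \<otimes> (a \<otimes> b)) = b1 \<otimes> b2"
          using dec'[OF Bm[OF 1(2) 2(2)] 2(1)] by simp_all
        moreover have "nat i1 < r" "int (nat i1) = i1" using 1(1) by (auto simp: V_def)
        moreover have "h (b1 \<otimes> b2) = h b2 \<circ> h b1" by (rule h(2)[OF 1(2) 2(2)])
        ultimately show ?thesis using j by (simp add: s_def d_def b1_i1_def b2_i2_def)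
      qed
      thus "s (a \<otimes>\<^bsub>?C\<^esub> b) j = s b (s a j) \<and> d (a \<otimes>\<^bsub>?C\<^esub> b) j = d b (s a j) \<circ> d a j"
        by (cases "j < r") (auto simp: s_def d_def)
    qed (use cl in simp)
    moreover have "inj_on (root_wreath n s d) C"
    proof (rule inj_onI)
      fix a b assume ab: "a \<in> C" "b \<in> C" "root_wreath n s d a = root_wreath n s d b"
      have n0: "0 < n" using r by (simp add: n_def)
      \<comment> \<open>Letter 0 stands for the coset \<open>B\<close> with representative \<one>,
        where the recursion shows \<open>idx a\<close> and \<open>cof a\<close> themselves.\<close>
      have "s a 0 = s b 0" "d a 0 = d b 0"
        using root_wreath_eqD[OF ab(3) n0] cl[OF ab(1) n0] cl[OF ab(2) n0] by auto
      hence "nat (idx a) = nat (idx b)" "h (cof a) = h (cof b)"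
        using r ab Cc by (simp_all add: s_def d_def)
      moreover have "idx a \<in> V" "idx b \<in> V" using dec ab by blast+
      hence "idx a \<ge> 0" "idx b \<ge> 0" by (auto simp: V_def)
      ultimately have "idx a = idx b" "cof a = cof b"
        using dec[OF ab(1)] dec[OF ab(2)] inj_onD[OF h(3)] by simp_all
      thus "a = b" using dec ab by metis
    qed
    ultimately show ?thesis unfolding fs_embeddable_def by auto
  next
    case False
    have uniq: "i = j" if "x [^] (i - j :: int) \<in> B" for i j
    proof (rule ccontr)
      assume "i \<noteq> j"
      have "x [^] (- (i - j)) = inv (x [^] (i - j))" using x by (rule int_pow_neg)
      hence "x [^] (j - i) \<in> B" using subgroup.m_inv_closed[OF B that] by simp
      hence "x [^] (int (nat \<bar>i - j\<bar>)) \<in> B" using that by (cases "i \<ge> j") auto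
      moreover have "nat \<bar>i - j\<bar> > 0" using \<open>i \<noteq> j\<close> by simp
      ultimately show False using False by blast
    qed
    have ex: "\<exists>b\<in>B. \<exists>i\<in>UNIV. c = b \<otimes> x [^] (i::int)" if "c \<in> C" for c
      using that C_eq by auto
    obtain idx cof
      where dec: "\<And>c. c \<in> C \<Longrightarrow> idx c \<in> (UNIV :: int set) \<and> cof c \<in> B \<and> c = cof c \<otimes> x [^] idx c"
      and dec': "\<And>b i. b \<in> B \<Longrightarrow> i \<in> UNIV \<Longrightarrow> idx (b \<otimes> x [^] i) = i \<and> cof (b \<otimes> x [^] i) = b"
      using cyclic_extension_normal_form[OF B x uniq ex] by blast
    define n where "n = max 2 k"
    have "fs_embeddable (G\<lparr>carrier := B\<rparr>) n" by (rule fs_embeddable_mono[OF emb]) (simp add: n_def)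
    then obtain h where h: "\<And>a. a \<in> B \<Longrightarrow> h a \<in> fs n"
      "\<And>a b. a \<in> B \<Longrightarrow> b \<in> B \<Longrightarrow> h (a \<otimes> b) = h b \<circ> h a" "inj_on h B"
      unfolding fs_embeddable_def hom_def by auto
    obtain z :: "int \<Rightarrow> nat list \<Rightarrow> nat list"
      where z: "\<And>i. z i \<in> fs n" "\<And>i j. z (i + j) = z j \<circ> z i" "inj z"
      using odometer[of n] by (metis max.cobounded1 n_def)
    define s where "s = (\<lambda>(a::'a) (j::nat). j)"
    \<comment> \<open>Letter 0 carries the infinite cyclic factor and every other letter carries
      \<open>B\<close>; \<open>n\<close> is at least 2, so letter 1 is present.\<close>
    define d where "d a j = (if j = (0::nat) then z (idx a) else h (cof a))" for a j
    have cl: "s a j < n \<and> d a j \<in> fs n" if "a \<in> C" "j < n" for a j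
    proof -
      have "cof a \<in> B" using dec[OF that(1)] by blast
      thus ?thesis using that(2) h(1) z(1) by (simp add: s_def d_def)
    qed
    have "root_wreath n s d \<in> hom ?C (fs_group n)"
    proof (rule root_wreath_hom[OF grp])
      fix a b j assume "a \<in> carrier ?C" "b \<in> carrier ?C"
      hence ab: "a \<in> C" "b \<in> C" by auto
      have B': "cof a \<in> B" "cof b \<in> B" using dec ab by blast+
      have *: "cof a \<in> carrier G" "cof b \<in> carrier G" using B' Bc by blast+
      have "a \<otimes> b = (cof a \<otimes> x [^] idx a) \<otimes> (cof b \<otimes> x [^] idx b)" using dec ab by metis
      also have "\<dots> = (cof a \<otimes> cof b) \<otimes> x [^] (idx a + idx b)"
        using * x pow by (simp add: m_ac)
      finally have "idx (a \<otimes> b) = idx a + idx b" "cof (a \<otimes> b) = cof a \<otimes> cof b"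
        using dec'[OF Bm[OF B'] UNIV_I] by simp_all
      thus "s (a \<otimes>\<^bsub>?C\<^esub> b) j = s b (s a j) \<and> d (a \<otimes>\<^bsub>?C\<^esub> b) j = d b (s a j) \<circ> d a j"
        using h(2)[OF B'] z(2) by (simp add: s_def d_def)
    qed (use cl in \<open>auto simp: s_def\<close>)
    moreover have "inj_on (root_wreath n s d) C"
    proof (rule inj_onI)
      fix a b assume ab: "a \<in> C" "b \<in> C" "root_wreath n s d a = root_wreath n s d b"
      have n: "0 < n" "1 < n" by (auto simp: n_def)
      have "d a 0 = d b 0" "d a 1 = d b 1"
        using root_wreath_eqD(2)[OF ab(3)] cl[OF ab(1)] cl[OF ab(2)] n by blast+
      hence "idx a = idx b" "cof a = cof b"
        using dec[OF ab(1)] dec[OF ab(2)] injD[OF z(3), of "idx a" "idx b"]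
          inj_onD[OF h(3), of "cof a" "cof b"] by (simp_all add: d_def)
      thus "a = b" using dec ab by metis
    qed
    ultimately show ?thesis unfolding fs_embeddable_def by auto
  qed
qed

lemma (in comm_group) generate_insert_int_pow:
  assumes "S \<subseteq> carrier G" "x \<in> carrier G"
  shows "generate G (insert x S) = {b \<otimes> x [^] (i::int) | b i. b \<in> generate G S}"
proof
  note gi = generate_in_carrier[OF assms(1)]
  note sub = generate_is_subgroup[OF assms(1)]
  show "generate G (insert x S) \<subseteq> {b \<otimes> x [^] (i::int) | b i. b \<in> generate G S}"
  proof
    fix c assume "c \<in> generate G (insert x S)"
    thus "c \<in> {b \<otimes> x [^] (i::int) | b i. b \<in> generate G S}"
    proof induct
      case one
      have "\<one> = \<one> \<otimes> x [^] (0::int)" by simp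
      thus ?case using generate.one by blast
    next
      case (incl c)
      show ?case
      proof (cases "c = x")
        case True
        hence "c = \<one> \<otimes> x [^] (1::int)" using assms by simp
        thus ?thesis using generate.one by blast
      next
        case False
        hence "c \<in> S" using incl by simp
        hence "c = c \<otimes> x [^] (0::int)" "c \<in> generate G S" using assms generate.incl by auto
        thus ?thesis by blast
      qed
    next
      case (inv c)
      show ?case
      proof (cases "c = x")
        case True
        hence "inv c = \<one> \<otimes> x [^] (-1::int)" using assms int_pow_neg[of x 1] by simp
        thus ?thesis using generate.one by blast
      next
        case False
        hence "c \<in> S" using inv by simp
        hence "inv c = inv c \<otimes> x [^] (0::int)" "inv c \<in> generate G S"
          using assms generate.inv by auto
        thus ?thesis by blast
      qed
    next
      case (eng c d)
      then obtain b i b' j where "c = b \<otimes> x [^] (i::int)" "d = b' \<otimes> x [^] (j::int)"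
        and b: "b \<in> generate G S" "b' \<in> generate G S" by blast
      hence "c \<otimes> d = (b \<otimes> b') \<otimes> x [^] (i + j)"
        using gi assms(2) by (simp add: int_pow_mult m_ac)
      moreover have "b \<otimes> b' \<in> generate G S" by (rule generate.eng[OF b])
      ultimately show ?case by blast
    qed
  qed
  have sub': "subgroup (generate G (insert x S)) G" using assms by (intro generate_is_subgroup) auto
  have "generate G S \<subseteq> generate G (insert x S)" by (rule mono_generate) auto
  moreover have "x [^] (i::int) \<in> generate G (insert x S)" for i
    by (intro subgroup_int_pow_closed[OF sub'] generate.incl) simp
  ultimately show "{b \<otimes> x [^] (i::int) | b i. b \<in> generate G S} \<subseteq> generate G (insert x S)"
    using subgroup.m_closed[OF sub'] by blast
qed

lemma (in comm_group) fs_embeddable_generate: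
  assumes "finite S" "S \<subseteq> carrier G"
  shows "\<exists>n. fs_embeddable (G\<lparr>carrier := generate G S\<rparr>) n"
  using assms
proof (induct S rule: finite_induct)
  case empty
  have "(\<lambda>_. id) \<in> hom (G\<lparr>carrier := generate G {}\<rparr>) (fs_group 0)"
    using fs_id by (auto simp: hom_def)
  moreover have "inj_on (\<lambda>_. id) (generate G {})" by (simp add: generate_empty)
  ultimately show ?case unfolding fs_embeddable_def by auto
next
  case (insert x S)
  then obtain k where "fs_embeddable (G\<lparr>carrier := generate G S\<rparr>) k" by auto
  thus ?case
    using fs_embeddable_cyclic_extension[of "generate G S" x "generate G (insert x S)"]
      generate_is_subgroup[of S] generate_is_subgroup[of "insert x S"]
      generate_insert_int_pow[of S x] insert.prems by auto
qed

section \<open>Separating group elements by a single word\<close>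

text \<open>An additional letter \<open>m\<close> resets the machine to its initial state \<open>g\<close>, which is therefore
  remembered as the first component. So \<open>g\<close> acts diagonally on lists of words separated by \<open>m\<close>, and
  words separating different pairs of elements can be concatenated.\<close>

lemma fs_group_separating_embedding:
  obtains \<rho> where "\<rho> \<in> hom (fs_group m) (fs_group (Suc m))"
    "\<And>F. finite F \<Longrightarrow> F \<subseteq> fs m \<Longrightarrow> \<exists>w\<in>words (Suc m). inj_on (\<lambda>g. \<rho> g w) F"
proof -
  define \<sigma> where "\<sigma> q j = (if j < m then hd (snd q [j]) else j)"
    for q :: "(nat list \<Rightarrow> nat list) \<times> (nat list \<Rightarrow> nat list)" and j
  define \<delta> where "\<delta> q j = (fst q, if j < m then state m (snd q) j else fst q)"
    for q :: "(nat list \<Rightarrow> nat list) \<times> (nat list \<Rightarrow> nat list)" and j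
  define \<rho> where "\<rho> g = machine (Suc m) \<sigma> \<delta> (g, g)" for g
  have mem: "\<rho> g \<in> fs (Suc m)" if g: "g \<in> fs m" for g
    unfolding \<rho>_def
  proof (rule machine_fs[where S = "{g} \<times> Qset m g"])
    show "finite ({g} \<times> Qset m g)" using g by (simp add: fs_iff finite_state_def)
    show "invertible (Suc m) \<sigma> \<delta> ({g} \<times> Qset m g)"
      using bij_betw_pad[OF tree_aut_root_bij, of m _ "Suc m"] Qset_fs[OF g] fs_tree_aut
      by (auto simp: invertible_def \<sigma>_def[abs_def] \<delta>_def intro: Qset.intros)
  qed (simp add: Qset.base)
  have mult: "\<rho> (b \<circ> a) = \<rho> b \<circ> \<rho> a" if "a \<in> fs m" "b \<in> fs m" for a b
    unfolding \<rho>_def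
  proof (rule machine_comp)
    \<comment> \<open>The remembered element and the current state are multiplied separately, since
      a reset brings the former back.\<close>
    let ?R = "\<lambda>p q r. tree_aut m (fst p) \<and> tree_aut m (snd p) \<and> tree_aut m (fst q) \<and>
      tree_aut m (snd q) \<and> r = (fst q \<circ> fst p, snd q \<circ> snd p)"
    show "?R (a, a) (b, b) (b \<circ> a, b \<circ> a)" using that fs_tree_aut by simp
    fix p q r j assume R: "?R p q r" and j: "j < Suc m"
    thus "\<sigma> p j < Suc m \<and> \<sigma> r j = \<sigma> q (\<sigma> p j) \<and> ?R (\<delta> p j) (\<delta> q (\<sigma> p j)) (\<delta> r j)"
      using tree_aut_single(2)[of m "snd p" j] hd_comp[of m "snd p" "snd q" j]
        state_comp[of m "snd p" "snd q" j]
      by (auto simp: \<sigma>_def \<delta>_def tree_aut_state less_SucI)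
  qed
  have run: "run \<sigma> \<delta> (g, h) (u @ m # w) = h u @ m # run \<sigma> \<delta> (g, g) w"
    if "tree_aut m h" "u \<in> words m" for g h u w
    using that
  proof (induct u arbitrary: h)
    case Nil thus ?case by (simp add: tree_aut_Nil \<sigma>_def \<delta>_def)
  next
    case (Cons j u)
    thus ?case using tree_aut_Cons[of m h j u] by (auto simp: \<sigma>_def \<delta>_def tree_aut_state)
  qed
  have sep: "\<exists>w\<in>words (Suc m). \<forall>(a, b)\<in>P. \<rho> a w \<noteq> \<rho> b w"
    if "finite P" "P \<subseteq> {(a, b). a \<in> fs m \<and> b \<in> fs m \<and> a \<noteq> b}" for P
    using that
  proof (induct P rule: finite_induct)
    case empty thus ?case by (auto intro: exI[of _ "[]"])
  next
    case (insert p P)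
    then obtain w where w: "w \<in> words (Suc m)" "\<forall>(a, b)\<in>P. \<rho> a w \<noteq> \<rho> b w" by auto
    obtain a b where p: "p = (a, b)" "a \<in> fs m" "b \<in> fs m" "a \<noteq> b" using insert.prems by auto
    then obtain u where u: "a u \<noteq> b u" by blast
    hence um: "u \<in> words m" using p fs_tree_aut tree_aut_outside by metis
    hence u': "u @ m # w \<in> words (Suc m)" using w words_mono[OF um] by simp
    have \<rho>: "\<rho> g (u @ m # w) = g u @ m # \<rho> g w" if "g \<in> fs m" for g
      using run[of g u g w] um u' w that by (simp add: \<rho>_def machine_def fs_tree_aut)
    have "\<rho> c (u @ m # w) \<noteq> \<rho> d (u @ m # w)" if "(c, d) \<in> insert p P" for c d
    proof -
      have cd: "c \<in> fs m" "d \<in> fs m" using that insert.prems by auto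
      \<comment> \<open>Equal lengths align the outputs block by block, so a difference before or
        after the reset letter survives the concatenation.\<close>
      have "length (c u) = length (d u)" using cd tree_aut_length fs_tree_aut by metis
      moreover have "c u \<noteq> d u \<or> \<rho> c w \<noteq> \<rho> d w" using that u p w(2) by auto
      ultimately show ?thesis using \<rho> cd by simp
    qed
    thus ?case using u' by blast
  qed
  show thesis
  proof (rule that)
    show "\<rho> \<in> hom (fs_group m) (fs_group (Suc m))" using mem mult by (simp add: hom_def)
    fix F assume F: "finite F" "F \<subseteq> fs m"
    hence "\<exists>w\<in>words (Suc m). \<forall>(a, b)\<in>{(a, b) \<in> F \<times> F. a \<noteq> b}. \<rho> a w \<noteq> \<rho> b w"
      by (intro sep) (auto intro: finite_subset[of _ "F \<times> F"])
    thus "\<exists>w\<in>words (Suc m). inj_on (\<lambda>g. \<rho> g w) F" unfolding inj_on_def by blast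
  qed
qed

section \<open>Lamplighter machines\<close>

text \<open>The letters below \<open>m * m\<close> encode pairs \<open>(x, y)\<close> as \<open>x * m + y\<close>. In a state \<open>Inl (c, g)\<close> the
  element \<open>g\<close> acts on the first coordinates only. The letter \<open>m * m\<close> ends the word \<open>p\<close> of pairs read so
  far, and what follows is acted upon by \<open>c p\<close>. The second coordinates serve as a query: in the image of
  \<open>(\<phi>, g)\<close>, the value \<open>c p\<close> is the product of the \<open>\<phi> x\<close> over those \<open>x\<close> that map the second coordinates
  of \<open>p\<close> to the first.\<close>

type_synonym lamp_state =
  "(((nat list \<Rightarrow> nat list \<Rightarrow> nat list) \<times> (nat list \<Rightarrow> nat list)) + (nat list \<Rightarrow> nat list))"

definition lamp_out :: "nat \<Rightarrow> lamp_state \<Rightarrow> nat \<Rightarrow> nat" where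
  "lamp_out m q j = (case q of
     Inl (c, g) \<Rightarrow> if j < m * m then hd (g [j div m]) * m + j mod m else j
   | Inr b \<Rightarrow> hd (b [j]))"

text \<open>\<open>c\<close> is a function of the pairs still to be read, so each pair replaces it
  by its residual. The pairs are recorded as read, not as written. A letter beyond
  \<open>m * m\<close> switches to the identity.\<close>

definition lamp_step :: "nat \<Rightarrow> nat \<Rightarrow> lamp_state \<Rightarrow> nat \<Rightarrow> lamp_state" where
  "lamp_step m n q j = (case q of
     Inl (c, g) \<Rightarrow> if j < m * m then Inl (\<lambda>p. c (j # p), state m g (j div m))
       else if j = m * m then Inr (c []) else Inr id
   | Inr b \<Rightarrow> Inr (state n b j))"

abbreviation divs :: "nat \<Rightarrow> nat list \<Rightarrow> nat list" where "divs m \<equiv> map (\<lambda>j. j div m)"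
abbreviation mods :: "nat \<Rightarrow> nat list \<Rightarrow> nat list" where "mods m \<equiv> map (\<lambda>j. j mod m)"

lemma words_divs: "p \<in> words (m * m) \<Longrightarrow> divs m p \<in> words m"
  by (induct p) (auto simp: less_mult_imp_div_less)

lemma words_mods: "0 < m \<Longrightarrow> mods m p \<in> words m"
  by (induct p) auto

lemma words_pair:
  assumes "u \<in> words m" "v \<in> words m" "length u = length v"
  obtains p where "p \<in> words (m * m)" "divs m p = u" "mods m p = v"
proof -
  have "\<exists>p\<in>words (m * m). divs m p = u \<and> mods m p = v"
    using assms(3,1,2)
  proof (induct u v rule: list_induct2)
    case Nil thus ?case by (auto intro: exI[of _ "[]"])
  next
    case (Cons x u y v)
    then obtain p where "p \<in> words (m * m)" "divs m p = u" "mods m p = v" by auto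
    moreover have "x * m + y < m * m"
    proof -
      have "x * m + y < Suc x * m" using Cons by simp
      also have "\<dots> \<le> m * m" using Cons by (intro mult_le_mono1) simp
      finally show ?thesis .
    qed
    ultimately show ?case using Cons by (intro bexI[of _ "(x * m + y) # p"]) auto
  qed
  thus thesis using that by blast
qed

lemma lamp_out_letter:
  assumes "tree_aut m g" "j < m * m"
  shows "lamp_out m (Inl (c, g)) j < m * m"
    "lamp_out m (Inl (c, g)) j div m = hd (g [j div m])"
    "lamp_out m (Inl (c, g)) j mod m = j mod m"
proof -
  have m: "0 < m" using assms(2) by (cases m) auto
  have h: "hd (g [j div m]) < m"
    by (rule tree_aut_single(2)[OF assms(1)]) (use assms(2) in \<open>simp add: less_mult_imp_div_less\<close>)
  have "hd (g [j div m]) * m + j mod m < Suc (hd (g [j div m])) * m" using m by simp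
  also have "\<dots> \<le> m * m" using h by (intro mult_le_mono1) simp
  finally show "lamp_out m (Inl (c, g)) j < m * m" using assms(2) by (simp add: lamp_out_def)
  show "lamp_out m (Inl (c, g)) j div m = hd (g [j div m])"
    using assms(2) m div_mult_self3[of m "j mod m" "hd (g [j div m])"] by (simp add: lamp_out_def)
qed (use assms(2) in \<open>auto simp: lamp_out_def\<close>)

lemma lamp_out_bij:
  assumes "tree_aut m g" "m * m < n"
  shows "bij_betw (lamp_out m (Inl (c, g))) {..<n} {..<n}"
proof -
  note L = lamp_out_letter[OF assms(1)]
  let ?f = "lamp_out m (Inl (c, g))"
  have "inj_on ?f {..<m * m}"
  proof (rule inj_onI)
    fix i j assume "i \<in> {..<m * m}" "j \<in> {..<m * m}" and eq: "?f i = ?f j"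
    hence ij: "i < m * m" "j < m * m" by auto
    have "hd (g [i div m]) = hd (g [j div m])" using L(2)[OF ij(1)] L(2)[OF ij(2)] eq by metis
    moreover have "i div m < m" "j div m < m" using ij by (auto simp: less_mult_imp_div_less)
    ultimately have "i div m = j div m"
      using tree_aut_root_bij[OF assms(1)] unfolding bij_betw_def inj_on_def by auto
    moreover have "i mod m = j mod m" using L(3)[OF ij(1)] L(3)[OF ij(2)] eq by metis
    ultimately show "i = j" by (metis div_mult_mod_eq)
  qed
  moreover have "?f ` {..<m * m} \<subseteq> {..<m * m}" using L(1) by auto
  ultimately have "bij_betw ?f {..<m * m} {..<m * m}" by (simp add: bij_betw_def endo_inj_surj)
  from bij_betw_pad[OF this, of n]
  have "bij_betw (\<lambda>j. if j < m * m then ?f j else j) {..<n} {..<n}" using assms(2) by simp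
  moreover have "(\<lambda>j. if j < m * m then ?f j else j) = ?f" by (auto simp: lamp_out_def)
  ultimately show ?thesis by simp
qed

text \<open>In \<open>comp\<close>, \<open>v\<close> is what the first machine writes on reading
  \<open>u\<close>; the second machine evaluates its lamps there.\<close>

lemma lamp_machine_comp:
  assumes n: "m * m < n"
    and g: "tree_aut m g1" "tree_aut m g2"
    and c: "\<And>u. tree_aut n (c1 u)" "\<And>u. tree_aut n (c2 u)"
    and comp: "\<And>u v. u \<in> words (m * m) \<Longrightarrow> divs m v = g1 (divs m u) \<Longrightarrow> mods m v = mods m u \<Longrightarrow>
      c u = c2 v \<circ> c1 u"
  shows "machine n (lamp_out m) (lamp_step m n) (Inl (c, g2 \<circ> g1)) =
    machine n (lamp_out m) (lamp_step m n) (Inl (c2, g2)) \<circ>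
    machine n (lamp_out m) (lamp_step m n) (Inl (c1, g1))"
proof -
  define R where "R p q r \<longleftrightarrow>
      (\<exists>c1 g1 c2 g2 c. p = Inl (c1, g1) \<and> q = Inl (c2, g2) \<and> r = Inl (c, g2 \<circ> g1) \<and>
        tree_aut m g1 \<and> tree_aut m g2 \<and> (\<forall>u. tree_aut n (c1 u)) \<and> (\<forall>u. tree_aut n (c2 u)) \<and>
        (\<forall>u\<in>words (m * m). \<forall>v. divs m v = g1 (divs m u) \<longrightarrow> mods m v = mods m u \<longrightarrow>
          c u = c2 v \<circ> c1 u))
    \<or> (\<exists>b1 b2. p = Inr b1 \<and> q = Inr b2 \<and> r = Inr (b2 \<circ> b1) \<and> tree_aut n b1 \<and> tree_aut n b2)"
    for p q r
  show ?thesis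
  proof (rule machine_comp[where R = R])
    show "R (Inl (c1, g1)) (Inl (c2, g2)) (Inl (c, g2 \<circ> g1))"
      unfolding R_def using g c comp by blast
    fix p q r j assume R: "R p q r" and j: "j < n"
    show "lamp_out m p j < n \<and> lamp_out m r j = lamp_out m q (lamp_out m p j) \<and>
      R (lamp_step m n p j) (lamp_step m n q (lamp_out m p j)) (lamp_step m n r j)"
    proof (cases p)
      case (Inr b1)
      then obtain b2 where b: "q = Inr b2" "r = Inr (b2 \<circ> b1)" "tree_aut n b1" "tree_aut n b2"
        using R unfolding R_def by auto
      have "hd (b1 [j]) < n" by (rule tree_aut_single(2)[OF b(3) j])
      thus ?thesis using Inr b hd_comp[OF b(3,4) j] state_comp[OF b(3,4) j] j tree_aut_state
        by (simp add: R_def lamp_out_def lamp_step_def)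
    next
      case (Inl cg)
      then obtain c1 g1 c2 g2 c where pqr: "p = Inl (c1, g1)" "q = Inl (c2, g2)"
          "r = Inl (c, g2 \<circ> g1)"
        and t: "tree_aut m g1" "tree_aut m g2" "\<And>u. tree_aut n (c1 u)" "\<And>u. tree_aut n (c2 u)"
        and comp: "\<And>u v. u \<in> words (m * m) \<Longrightarrow> divs m v = g1 (divs m u) \<Longrightarrow> mods m v = mods m u \<Longrightarrow>
          c u = c2 v \<circ> c1 u"
        using R unfolding R_def by blast
      have idn: "tree_aut n id" using fs_id fs_tree_aut by blast
      show ?thesis
      proof (cases "j < m * m")
        case False
        hence o: "lamp_out m (Inl (c', g')) j = j" for c' g' by (simp add: lamp_out_def)
        \<comment> \<open>At the terminator the residuals are evaluated at the empty word, where
          \<open>comp\<close> becomes the product rule for what follows.\<close>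
        have "c [] = c2 [] \<circ> c1 []"
          using comp[of "[]" "[]"] tree_aut_Nil[OF t(1)] by simp
        thus ?thesis using False j idn t(3,4)
          unfolding pqr o by (auto simp: lamp_step_def R_def)
      next
        case True
        define k where "k = lamp_out m p j"
        have k: "k < m * m" "k div m = hd (g1 [j div m])" "k mod m = j mod m"
          using lamp_out_letter[OF t(1) True] by (simp_all add: k_def pqr)
        have jm: "j div m < m" using True by (simp add: less_mult_imp_div_less)
        have km: "hd (g1 [j div m]) < m" by (rule tree_aut_single(2)[OF t(1) jm])
        have out: "lamp_out m r j = lamp_out m q k"
          using True k hd_comp[OF t(1,2) jm] by (simp add: pqr lamp_out_def)
        have step: "lamp_step m n p j = Inl (\<lambda>u. c1 (j # u), state m g1 (j div m))"
          "lamp_step m n q k = Inl (\<lambda>u. c2 (k # u), state m g2 (hd (g1 [j div m])))"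
          "lamp_step m n r j = Inl (\<lambda>u. c (j # u), state m g2 (hd (g1 [j div m])) \<circ> state m g1 (j div m))"
          using True k state_comp[OF t(1,2) jm] by (simp_all add: pqr lamp_step_def)
        \<comment> \<open>Residuals inherit \<open>comp\<close>: prepend the letter \<open>j\<close>
          read to \<open>u\<close> and the letter \<open>k\<close> written to
          \<open>v\<close>.\<close>
        have "c (j # u) = c2 (k # v) \<circ> c1 (j # u)"
          if u: "u \<in> words (m * m)" "divs m v = state m g1 (j div m) (divs m u)" "mods m v = mods m u"
          for u v
        proof (rule comp)
          show "divs m (k # v) = g1 (divs m (j # u))"
            using tree_aut_Cons[OF t(1) jm words_divs[OF u(1)]] u(2) k(2) by simp
        qed (use u True k in auto)
        hence "R (lamp_step m n p j) (lamp_step m n q k) (lamp_step m n r j)"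
          unfolding step R_def using t tree_aut_state[OF t(1) jm] tree_aut_state[OF t(2) km] by blast
        thus ?thesis using out k n unfolding k_def by auto
      qed
    qed
  qed
qed

text \<open>For injectivity: the output reveals the action of \<open>g\<close> on the first
  coordinates and the action of \<open>c p\<close> behind the terminator.\<close>

lemma lamp_run:
  assumes "tree_aut m g" "p \<in> words (m * m)" "tree_aut n (c p)" "v \<in> words n"
  shows "\<exists>p'. length p' = length p \<and> divs m p' = g (divs m p) \<and>
    run (lamp_out m) (lamp_step m n) (Inl (c, g)) (p @ m * m # v) = p' @ m * m # c p v"
  using assms
proof (induct p arbitrary: c g)
  case Nil
  have "run (lamp_out m) (lamp_step m n) (Inr (c [])) v = c [] v"
    by (rule run_eq_aut) (use Nil in \<open>simp_all add: lamp_out_def lamp_step_def\<close>)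
  moreover have "lamp_out m (Inl (c, g)) (m * m) = m * m"
    "lamp_step m n (Inl (c, g)) (m * m) = Inr (c [])"
    by (simp_all add: lamp_out_def lamp_step_def)
  ultimately show ?case using Nil(1) by (simp add: tree_aut_Nil)
next
  case (Cons j p)
  have j: "j < m * m" "p \<in> words (m * m)" using Cons.prems by auto
  have jm: "j div m < m" using j by (simp add: less_mult_imp_div_less)
  obtain p' where p': "length p' = length p" "divs m p' = state m g (j div m) (divs m p)"
    "run (lamp_out m) (lamp_step m n) (Inl (\<lambda>u. c (j # u), state m g (j div m))) (p @ m * m # v)
      = p' @ m * m # c (j # p) v"
    using Cons.hyps[OF tree_aut_state[OF Cons.prems(1) jm] j(2), of "\<lambda>u. c (j # u)"] Cons.prems by auto
  let ?k = "lamp_out m (Inl (c, g)) j"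
  have "lamp_step m n (Inl (c, g)) j = Inl (\<lambda>u. c (j # u), state m g (j div m))"
    using j by (simp add: lamp_step_def)
  moreover have "divs m (?k # p') = g (divs m (j # p))"
    using tree_aut_Cons[OF Cons.prems(1) jm words_divs[OF j(2)]] p'(2)
      lamp_out_letter(2)[OF Cons.prems(1) j(1)] by simp
  ultimately show ?case using p' by (intro exI[of _ "?k # p'"]) auto
qed

section \<open>Embedding the wreath product\<close>

text \<open>\<open>separating\<close> asks for one word per finite set, which already makes \<rho>
  faithful. \<open>mn\<close> makes room for the terminator \<open>m * m\<close> among the
  \<open>n\<close> letters, over which \<eta> acts too.\<close>

locale fs_wreath = A: comm_group A + G: group G
  for A :: "('a, 'c) monoid_scheme" and G :: "('g, 'd) monoid_scheme" +
  fixes m n :: nat and \<rho> :: "'g \<Rightarrow> nat list \<Rightarrow> nat list" and \<eta> :: "'a \<Rightarrow> nat list \<Rightarrow> nat list"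
  assumes \<rho>_hom: "\<rho> \<in> hom G (fs_group m)"
    and separating: "\<And>F. finite F \<Longrightarrow> F \<subseteq> carrier G \<Longrightarrow> \<exists>w\<in>words m. inj_on (\<lambda>g. \<rho> g w) F"
    and \<eta>_hom: "\<eta> \<in> hom A (fs_group n)"
    and \<eta>_inj: "inj_on \<eta> (carrier A)"
    and m_pos: "0 < m" and mn: "m * m < n"
begin

lemma \<rho>_fs: "g \<in> carrier G \<Longrightarrow> \<rho> g \<in> fs m"
  using \<rho>_hom by (auto simp: hom_def)

lemma \<rho>_aut: "g \<in> carrier G \<Longrightarrow> tree_aut m (\<rho> g)"
  using \<rho>_fs fs_tree_aut by blast

lemma \<rho>_mult: "g \<in> carrier G \<Longrightarrow> h \<in> carrier G \<Longrightarrow> \<rho> (g \<otimes>\<^bsub>G\<^esub> h) = \<rho> h \<circ> \<rho> g"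
  using \<rho>_hom by (auto simp: hom_def)

lemma \<eta>_fs: "a \<in> carrier A \<Longrightarrow> \<eta> a \<in> fs n"
  using \<eta>_hom by (auto simp: hom_def)

lemma \<eta>_mult: "a \<in> carrier A \<Longrightarrow> b \<in> carrier A \<Longrightarrow> \<eta> (a \<otimes>\<^bsub>A\<^esub> b) = \<eta> b \<circ> \<eta> a"
  using \<eta>_hom by (auto simp: hom_def)

definition supp :: "('g \<Rightarrow> 'a) \<Rightarrow> 'g set" where
  "supp \<phi> = {x \<in> carrier G. \<phi> x \<noteq> \<one>\<^bsub>A\<^esub>}"

definition lamps :: "('g \<Rightarrow> 'a) \<Rightarrow> nat list \<Rightarrow> nat list \<Rightarrow> nat list" where
  "lamps \<phi> p = \<eta> (finprod A \<phi> {x \<in> supp \<phi>. \<rho> x (mods m p) = divs m p})"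

definition emb :: "('g \<Rightarrow> 'a) \<times> 'g \<Rightarrow> nat list \<Rightarrow> nat list" where
  "emb = (\<lambda>(\<phi>, g). machine n (lamp_out m) (lamp_step m n) (Inl (lamps \<phi>, \<rho> g)))"

definition base :: "('g \<Rightarrow> 'a) set" where
  "base = {\<phi> \<in> extensional (carrier G). \<phi> \<in> carrier G \<rightarrow> carrier A \<and> finite (supp \<phi>)}"

lemma carrier_wreath: "carrier (wreath A G) = base \<times> carrier G"
  by (auto simp: wreath_def base_def supp_def)

lemma supp_subset: "supp \<phi> \<subseteq> carrier G"
  by (auto simp: supp_def)

lemma base_closed: "\<phi> \<in> base \<Longrightarrow> x \<in> carrier G \<Longrightarrow> \<phi> x \<in> carrier A"
  by (auto simp: base_def)

lemma finprod_base_closed: "\<phi> \<in> base \<Longrightarrow> B \<subseteq> carrier G \<Longrightarrow> finprod A \<phi> B \<in> carrier A"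
  using base_closed by (intro A.finprod_closed) auto

lemma lamps_aut: "\<phi> \<in> base \<Longrightarrow> tree_aut n (lamps \<phi> p)"
  unfolding lamps_def using supp_subset
  by (intro fs_tree_aut \<eta>_fs finprod_base_closed) auto

text \<open>Brings products over supports of different lamp functions to one common finite set; the
  added points contribute \<one>.\<close>

lemma finprod_supp_superset:
  assumes "\<phi> \<in> base" "finite E" "E \<subseteq> carrier G" "{x \<in> supp \<phi>. P x} \<subseteq> E" "\<And>x. x \<in> E \<Longrightarrow> P x"
  shows "finprod A \<phi> {x \<in> supp \<phi>. P x} = finprod A \<phi> E"
proof (rule A.finprod_mono_neutral_cong_left[OF assms(2,4)])
  show "\<phi> i = \<one>\<^bsub>A\<^esub>" if "i \<in> E - {x \<in> supp \<phi>. P x}" for i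
    using that assms(3,5) by (auto simp: supp_def)
qed (use assms(3) base_closed[OF assms(1)] in auto)

text \<open>Every state reached from \<open>emb (\<phi>, g)\<close> by reading pairs is described by the set \<open>B\<close> of lamps that
  agree with the query so far and by the states of the \<open>\<rho> x\<close> that they have reached.\<close>

lemma emb_fs:
  assumes \<phi>: "\<phi> \<in> base" and g: "g \<in> carrier G"
  shows "emb (\<phi>, g) \<in> fs n"
proof -
  define L where "L B s p = \<eta> (finprod A \<phi> {x \<in> B. s x (mods m p) = divs m p})"
    for B and s :: "'g \<Rightarrow> nat list \<Rightarrow> nat list" and p
  \<comment> \<open>Finite, because the support is finite and each \<open>\<rho> x\<close> is
    finite-state; \<open>PiE\<close> pins the functions down off the support.\<close>
  define Y where "Y = Pow (supp \<phi>) \<times> PiE (supp \<phi>) (\<lambda>x. Qset m (\<rho> x))"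
  define C where "C = (\<lambda>(B, s). L B s) ` Y"
  \<comment> \<open>The states possible once the pairs have ended: those of the value of any
    surviving set of lamps, and \<open>id\<close>.\<close>
  define D where "D = Qset n id \<union> (\<Union>B\<in>Pow (supp \<phi>). Qset n (\<eta> (finprod A \<phi> B)))"
  have fin: "finite (supp \<phi>)" using \<phi> by (simp add: base_def)
  have fin_Q: "finite (Qset k a)" if "a \<in> fs k" for a k using that by (simp add: fs_iff finite_state_def)
  have \<eta>B: "\<eta> (finprod A \<phi> B) \<in> fs n" if "B \<subseteq> supp \<phi>" for B
    using that supp_subset by (intro \<eta>_fs finprod_base_closed[OF \<phi>]) auto
  have D_fs: "D \<subseteq> fs n" unfolding D_def using Qset_fs fs_id \<eta>B by blast
  have D_step: "state n b j \<in> D" if "b \<in> D" "j < n" for b j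
    using that Qset.step unfolding D_def by blast
  have C_Nil: "c [] \<in> D" if c: "c \<in> C" for c
  proof -
    obtain B s where Bs: "c = L B s" "B \<subseteq> supp \<phi>" "s \<in> PiE (supp \<phi>) (\<lambda>x. Qset m (\<rho> x))"
      using c by (auto simp: C_def Y_def)
    have "s x [] = []" if "x \<in> B" for x
    proof -
      have "s x \<in> Qset m (\<rho> x)" "x \<in> carrier G" using that Bs supp_subset by auto
      thus ?thesis using Qset_fs[OF \<rho>_fs] fs_tree_aut tree_aut_Nil by blast
    qed
    \<comment> \<open>Lamps that failed to match have been discarded on the way, so at the
      terminator all of \<open>B\<close> counts.\<close>
    hence "{x \<in> B. s x [] = []} = B" by blast
    hence "c [] = \<eta> (finprod A \<phi> B)" by (simp add: Bs(1) L_def)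
    hence "c [] \<in> Qset n (\<eta> (finprod A \<phi> B))" by (simp add: Qset.base)
    thus ?thesis using Bs(2) unfolding D_def by blast
  qed
  have C_Cons: "(\<lambda>p. c (j # p)) \<in> C" if c: "c \<in> C" and j: "j < m * m" for c j
  proof -
    obtain B s where Bs: "c = L B s" "B \<subseteq> supp \<phi>" "s \<in> PiE (supp \<phi>) (\<lambda>x. Qset m (\<rho> x))"
      using c by (auto simp: C_def Y_def)
    have jm: "j mod m < m" using m_pos by simp
    \<comment> \<open>A lamp survives the letter \<open>j\<close> iff its current state sends the
      query letter \<open>j mod m\<close> to \<open>j div m\<close>.\<close>
    define B' where "B' = {x \<in> B. hd (s x [j mod m]) = j div m}"
    define s' where "s' = (\<lambda>x\<in>supp \<phi>. state m (s x) (j mod m))"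
    have sx: "s x \<in> Qset m (\<rho> x)" "tree_aut m (s x)" if "x \<in> supp \<phi>" for x
    proof -
      show "s x \<in> Qset m (\<rho> x)" using that Bs by auto
      thus "tree_aut m (s x)" using that supp_subset Qset_fs[OF \<rho>_fs] fs_tree_aut by blast
    qed
    have "{x \<in> B. s x (mods m (j # p)) = divs m (j # p)} = {x \<in> B'. s' x (mods m p) = divs m p}" for p
    proof -
      have "s x (mods m (j # p)) = hd (s x [j mod m]) # s' x (mods m p)" if "x \<in> B" for x
        using tree_aut_Cons[OF sx(2) jm words_mods[OF m_pos]] that Bs(2) by (auto simp: s'_def)
      thus ?thesis by (auto simp: B'_def)
    qed
    hence "(\<lambda>p. c (j # p)) = L B' s'" unfolding Bs(1) L_def by presburger
    moreover have "(B', s') \<in> Y"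
      using Bs(2) sx(1) jm by (auto simp: Y_def B'_def s'_def intro: Qset.step)
    ultimately show ?thesis unfolding C_def by (auto intro: rev_image_eqI)
  qed
  let ?S = "Inl ` (C \<times> Qset m (\<rho> g)) \<union> Inr ` D"
  show ?thesis unfolding emb_def prod.case
  proof (rule machine_fs[where S = ?S])
    have "finite (Qset m (\<rho> x))" if "x \<in> supp \<phi>" for x
      using fin_Q[OF \<rho>_fs] that supp_subset by blast
    hence "finite Y" unfolding Y_def using fin by (simp add: finite_PiE)
    moreover have "finite D" unfolding D_def using fin fin_Q fs_id \<eta>B by auto
    ultimately show "finite ?S" using fin_Q \<rho>_fs g by (auto simp: C_def)
    have "lamps \<phi> = L (supp \<phi>) (restrict \<rho> (supp \<phi>))"
      unfolding lamps_def L_def by (intro ext arg_cong[where f = \<eta>] arg_cong[where f = "finprod A \<phi>"]) auto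
    hence "lamps \<phi> \<in> C"
      unfolding C_def Y_def by (auto intro!: rev_image_eqI[of "(supp \<phi>, restrict \<rho> (supp \<phi>))"] Qset.base)
    thus "Inl (lamps \<phi>, \<rho> g) \<in> ?S" by (auto intro: Qset.base)
    show "invertible n (lamp_out m) (lamp_step m n) ?S"
      unfolding invertible_def
    proof (intro ballI conjI allI impI)
      fix q assume q: "q \<in> ?S"
      then consider c h where "q = Inl (c, h)" "c \<in> C" "h \<in> Qset m (\<rho> g)" | b where "q = Inr b" "b \<in> D"
        by auto
      note cs = this
      show "bij_betw (lamp_out m q) {..<n} {..<n}"
        using cs
      proof cases
        case 1
        hence "tree_aut m h" using Qset_fs[OF \<rho>_fs[OF g]] fs_tree_aut by blast
        thus ?thesis using lamp_out_bij mn 1 by blast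
      next
        case 2
        hence "tree_aut n b" using D_fs fs_tree_aut by blast
        thus ?thesis using tree_aut_root_bij 2 by (simp add: lamp_out_def[abs_def])
      qed
      fix j assume j: "j < n"
      show "lamp_step m n q j \<in> ?S"
        using cs
      proof cases
        case 1
        have "id \<in> D" by (simp add: D_def Qset.base)
        moreover have "state m h (j div m) \<in> Qset m (\<rho> g)" if "j < m * m"
          using 1 that by (intro Qset.step) (auto simp: less_mult_imp_div_less)
        ultimately show ?thesis using 1 C_Nil C_Cons by (auto simp: lamp_step_def)
      next
        case 2
        thus ?thesis using D_step j by (auto simp: lamp_step_def)
      qed
    qed
  qed
qed

text \<open>Right translation by \<open>g\<close> carries the lamps matching \<open>u\<close> to
  those matching \<open>v\<close>, so the factor \<phi>2 is evaluated at the translated lamps, as in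
  the product of the wreath group.\<close>

lemma lamps_mult:
  assumes \<phi>: "\<phi>1 \<in> base" "\<phi>2 \<in> base" and g: "g \<in> carrier G"
    and \<phi>_eq: "\<phi> = (\<lambda>x\<in>carrier G. \<phi>1 x \<otimes>\<^bsub>A\<^esub> \<phi>2 (x \<otimes>\<^bsub>G\<^esub> g))"
    and uv: "u \<in> words (m * m)" "divs m v = \<rho> g (divs m u)" "mods m v = mods m u"
  shows "\<phi> \<in> base" "lamps \<phi> u = lamps \<phi>2 v \<circ> lamps \<phi>1 u"
proof -
  \<comment> \<open>A finite set outside which both factors of \<phi> are trivial.\<close>
  define E where "E = supp \<phi>1 \<union> {x \<in> carrier G. x \<otimes>\<^bsub>G\<^esub> g \<in> supp \<phi>2}"
  have inj: "inj_on (\<lambda>x. x \<otimes>\<^bsub>G\<^esub> g) (carrier G)"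
    using g by (auto simp: inj_on_def)
  have "finite {x \<in> carrier G. x \<otimes>\<^bsub>G\<^esub> g \<in> supp \<phi>2}"
  proof (rule finite_imageD[OF finite_subset])
    show "(\<lambda>x. x \<otimes>\<^bsub>G\<^esub> g) ` {x \<in> carrier G. x \<otimes>\<^bsub>G\<^esub> g \<in> supp \<phi>2} \<subseteq> supp \<phi>2" by blast
    show "finite (supp \<phi>2)" using \<phi>(2) by (simp add: base_def)
    show "inj_on (\<lambda>x. x \<otimes>\<^bsub>G\<^esub> g) {x \<in> carrier G. x \<otimes>\<^bsub>G\<^esub> g \<in> supp \<phi>2}"
      by (rule inj_on_subset[OF inj]) blast
  qed
  hence finE: "finite E" using \<phi>(1) by (simp add: E_def base_def)
  have E: "E \<subseteq> carrier G" by (auto simp: E_def supp_def)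
  have suppE: "supp \<phi> \<subseteq> E"
    using g by (auto simp: supp_def E_def \<phi>_eq)
  show \<phi>b: "\<phi> \<in> base"
    using finite_subset[OF suppE finE] base_closed[OF \<phi>(1)] base_closed[OF \<phi>(2)] g
    by (auto simp: base_def \<phi>_eq)
  define P where "P x \<longleftrightarrow> \<rho> x (mods m u) = divs m u" for x
  define Q where "Q y \<longleftrightarrow> \<rho> y (mods m v) = divs m v" for y
  \<comment> \<open>The query is the same in \<open>u\<close> and \<open>v\<close>, and the
    injective map \<open>\<rho> g\<close> is applied to both sides of the matching
    condition.\<close>
  have PQ: "Q (x \<otimes>\<^bsub>G\<^esub> g) \<longleftrightarrow> P x" if "x \<in> carrier G" for x
    using that g uv tree_aut_inject[OF \<rho>_aut[OF g]] tree_aut_words[OF \<rho>_aut[OF that]]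
      words_mods[OF m_pos] words_divs[OF uv(1)]
    by (simp add: P_def Q_def \<rho>_mult)
  define F where "F = {x \<in> E. P x}"
  have F: "finite F" "F \<subseteq> carrier G" using finE E by (auto simp: F_def)
  have "finprod A \<phi> {x \<in> supp \<phi>. P x} = finprod A \<phi> F"
    using suppE by (intro finprod_supp_superset[OF \<phi>b F]) (auto simp: F_def)
  also have "\<dots> = finprod A (\<lambda>x. \<phi>1 x \<otimes>\<^bsub>A\<^esub> \<phi>2 (x \<otimes>\<^bsub>G\<^esub> g)) F"
    using F(2) base_closed[OF \<phi>(1)] base_closed[OF \<phi>(2)] g
    by (intro A.finprod_cong') (auto simp: \<phi>_eq)
  also have "\<dots> = finprod A \<phi>1 F \<otimes>\<^bsub>A\<^esub> finprod A (\<lambda>x. \<phi>2 (x \<otimes>\<^bsub>G\<^esub> g)) F"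
    using F(2) base_closed[OF \<phi>(1)] base_closed[OF \<phi>(2)] g by (intro A.finprod_multf) auto
  also have "finprod A \<phi>1 F = finprod A \<phi>1 {x \<in> supp \<phi>1. P x}"
    by (rule finprod_supp_superset[OF \<phi>(1) F, symmetric]) (auto simp: F_def E_def)
  also have "finprod A (\<lambda>x. \<phi>2 (x \<otimes>\<^bsub>G\<^esub> g)) F = finprod A \<phi>2 ((\<lambda>x. x \<otimes>\<^bsub>G\<^esub> g) ` F)"
    using F(2) base_closed[OF \<phi>(2)] g inj_on_subset[OF inj F(2)]
    by (intro A.finprod_reindex[symmetric]) auto
  also have "\<dots> = finprod A \<phi>2 {y \<in> supp \<phi>2. Q y}"
  proof (rule finprod_supp_superset[OF \<phi>(2), symmetric])
    show "{y \<in> supp \<phi>2. Q y} \<subseteq> (\<lambda>x. x \<otimes>\<^bsub>G\<^esub> g) ` F"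
    proof
      fix y assume y: "y \<in> {y \<in> supp \<phi>2. Q y}"
      hence yG: "y \<in> carrier G" using supp_subset by auto
      hence "y = (y \<otimes>\<^bsub>G\<^esub> inv\<^bsub>G\<^esub> g) \<otimes>\<^bsub>G\<^esub> g" using g by (simp add: G.m_assoc)
      moreover from this have "y \<otimes>\<^bsub>G\<^esub> inv\<^bsub>G\<^esub> g \<in> F"
        using y yG g PQ[of "y \<otimes>\<^bsub>G\<^esub> inv\<^bsub>G\<^esub> g"] by (auto simp: F_def E_def)
      ultimately show "y \<in> (\<lambda>x. x \<otimes>\<^bsub>G\<^esub> g) ` F" by blast
    qed
    show "\<And>y. y \<in> (\<lambda>x. x \<otimes>\<^bsub>G\<^esub> g) ` F \<Longrightarrow> Q y" using PQ F(2) by (auto simp: F_def)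
  qed (use F g in auto)
  finally have "finprod A \<phi> {x \<in> supp \<phi>. P x} =
    finprod A \<phi>1 {x \<in> supp \<phi>1. P x} \<otimes>\<^bsub>A\<^esub> finprod A \<phi>2 {y \<in> supp \<phi>2. Q y}" .
  moreover have "finprod A \<phi>1 {x \<in> supp \<phi>1. P x} \<in> carrier A" "finprod A \<phi>2 {y \<in> supp \<phi>2. Q y} \<in> carrier A"
    using supp_subset by (intro finprod_base_closed \<phi>; auto)+
  ultimately show "lamps \<phi> u = lamps \<phi>2 v \<circ> lamps \<phi>1 u"
    using \<eta>_mult by (simp add: lamps_def P_def Q_def)
qed

lemma emb_hom: "emb \<in> hom (wreath A G) (fs_group n)"
proof (rule homI)
  fix x assume "x \<in> carrier (wreath A G)"
  thus "emb x \<in> fs n" using emb_fs by (auto simp: carrier_wreath)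
  fix y assume "y \<in> carrier (wreath A G)"
  then obtain \<phi>1 g1 \<phi>2 g2 where xy: "x = (\<phi>1, g1)" "y = (\<phi>2, g2)" "\<phi>1 \<in> base" "\<phi>2 \<in> base"
      "g1 \<in> carrier G" "g2 \<in> carrier G"
    using \<open>x \<in> carrier (wreath A G)\<close> by (auto simp: carrier_wreath)
  let ?\<phi> = "\<lambda>x\<in>carrier G. \<phi>1 x \<otimes>\<^bsub>A\<^esub> \<phi>2 (x \<otimes>\<^bsub>G\<^esub> g1)"
  have "x \<otimes>\<^bsub>wreath A G\<^esub> y = (?\<phi>, g1 \<otimes>\<^bsub>G\<^esub> g2)" by (simp add: wreath_def xy)
  moreover have "emb (?\<phi>, g1 \<otimes>\<^bsub>G\<^esub> g2) = emb y \<circ> emb x"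
    unfolding emb_def xy prod.case \<rho>_mult[OF xy(5,6)]
    using lamps_mult(2)[OF xy(3,4,5) refl]
    by (intro lamp_machine_comp mn \<rho>_aut xy lamps_aut) auto
  ultimately show "emb (x \<otimes>\<^bsub>wreath A G\<^esub> y) = emb x \<otimes>\<^bsub>fs_group n\<^esub> emb y" by simp
qed

lemma emb_inj: "inj_on emb (carrier (wreath A G))"
proof (rule inj_onI)
  fix x y assume "x \<in> carrier (wreath A G)" "y \<in> carrier (wreath A G)" and eq: "emb x = emb y"
  then obtain \<phi>1 g1 \<phi>2 g2 where xy: "x = (\<phi>1, g1)" "y = (\<phi>2, g2)" "\<phi>1 \<in> base" "\<phi>2 \<in> base"
      "g1 \<in> carrier G" "g2 \<in> carrier G"
    by (auto simp: carrier_wreath)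
  let ?run = "run (lamp_out m) (lamp_step m n)"
  have key: "\<rho> g1 (divs m p) = \<rho> g2 (divs m p) \<and> lamps \<phi>1 p v = lamps \<phi>2 p v"
    if p: "p \<in> words (m * m)" and v: "v \<in> words n" for p v
  proof -
    have w: "p @ m * m # v \<in> words n" using words_mono[OF p] v mn by simp
    hence run: "?run (Inl (lamps \<phi>1, \<rho> g1)) (p @ m * m # v) = ?run (Inl (lamps \<phi>2, \<rho> g2)) (p @ m * m # v)"
      using fun_cong[OF eq, of "p @ m * m # v"] by (simp add: emb_def machine_def xy)
    obtain p1 where p1: "length p1 = length p" "divs m p1 = \<rho> g1 (divs m p)"
      "?run (Inl (lamps \<phi>1, \<rho> g1)) (p @ m * m # v) = p1 @ m * m # lamps \<phi>1 p v"
      using lamp_run[where c = "lamps \<phi>1", OF \<rho>_aut[OF xy(5)] p lamps_aut[OF xy(3)] v] by blast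
    obtain p2 where p2: "length p2 = length p" "divs m p2 = \<rho> g2 (divs m p)"
      "?run (Inl (lamps \<phi>2, \<rho> g2)) (p @ m * m # v) = p2 @ m * m # lamps \<phi>2 p v"
      using lamp_run[where c = "lamps \<phi>2", OF \<rho>_aut[OF xy(6)] p lamps_aut[OF xy(4)] v] by blast
    show ?thesis using p1 p2 run by simp
  qed
  obtain w where w: "w \<in> words m" "inj_on (\<lambda>g. \<rho> g w) {g1, g2}"
    using separating[of "{g1, g2}"] xy by auto
  \<comment> \<open>Only the first coordinates matter for recovering the group element;
    \<open>w\<close> is reused as the query.\<close>
  obtain p where p: "p \<in> words (m * m)" "divs m p = w" by (rule words_pair[OF w(1) w(1) refl])
  have "\<rho> g1 w = \<rho> g2 w" using key[OF p(1), of "[]"] p(2) by simp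
  hence "g1 = g2" using inj_onD[OF w(2), of g1 g2] by simp
  moreover have "\<phi>1 z = \<phi>2 z" if z: "z \<in> carrier G" for z
  proof -
    have "finite (insert z (supp \<phi>1 \<union> supp \<phi>2))" using xy by (simp add: base_def)
    then obtain w where w: "w \<in> words m" "inj_on (\<lambda>g. \<rho> g w) (insert z (supp \<phi>1 \<union> supp \<phi>2))"
      using separating[of "insert z (supp \<phi>1 \<union> supp \<phi>2)"] z supp_subset by auto
    obtain p where p: "p \<in> words (m * m)" "divs m p = \<rho> z w" "mods m p = w"
      using words_pair[OF tree_aut_words[OF \<rho>_aut[OF z] w(1)] w(1)] tree_aut_length[OF \<rho>_aut[OF z]]
      by metis
    have lamp: "lamps \<phi> p = \<eta> (\<phi> z)" if "\<phi> \<in> base" "supp \<phi> \<subseteq> supp \<phi>1 \<union> supp \<phi>2" for \<phi>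
    proof -
      \<comment> \<open>By separation no lamp other than \<open>z\<close> matches. If
        \<open>z\<close> lies outside the support, the left product is empty and
        \<open>\<phi> z\<close> is \<one>.\<close>
      have "finprod A \<phi> {x \<in> supp \<phi>. \<rho> x w = \<rho> z w} = finprod A \<phi> {z}"
        using w(2) that z by (intro finprod_supp_superset) (auto simp: inj_on_def)
      thus ?thesis using base_closed[OF that(1) z] by (simp add: lamps_def p)
    qed
    have "\<eta> (\<phi>1 z) v = \<eta> (\<phi>2 z) v" for v
    proof (cases "v \<in> words n")
      case True
      thus ?thesis using key[OF p(1) True] lamp[OF xy(3)] lamp[OF xy(4)] by simp
    next
      case False
      thus ?thesis
        using base_closed[OF xy(3) z] base_closed[OF xy(4) z] \<eta>_fs fs_tree_aut tree_aut_outside by metis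
    qed
    thus ?thesis using \<eta>_inj base_closed[OF xy(3) z] base_closed[OF xy(4) z]
      by (auto simp: inj_on_def fun_eq_iff)
  qed
  hence "\<phi>1 = \<phi>2" using xy(3,4) by (intro extensionalityI[of _ "carrier G"]) (auto simp: base_def)
  ultimately show "x = y" using xy by simp
qed

end

section \<open>The action induced by simple data\<close>

lemma data_phi_eq_machine:
  "data_phi G s H f T e = machine (data_m G s H) (data_sigma G s H T e) (data_sec G H f T e)"
proof -
  have "data_act G s H f T e g w = run (data_sigma G s H T e) (data_sec G H f T e) g w" for g w
    by (induct w arbitrary: g) auto
  thus ?thesis by (simp add: data_phi_def machine_def fun_eq_iff)
qed

lemma (in group) rep_props:
  assumes "subgroup K G" "right_transversal G K T" "a \<in> carrier G"
  shows "rep G K T a \<in> T" "rep G K T a \<in> carrier G" "K #> rep G K T a = K #> a"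
    "a \<otimes> inv (rep G K T a) \<in> K"
proof -
  have "\<exists>!t. t \<in> T \<and> K #> t = K #> a" using assms by (auto simp: right_transversal_def)
  from theI'[OF this] show 1: "rep G K T a \<in> T" "K #> rep G K T a = K #> a"
    by (simp_all add: rep_def)
  thus 2: "rep G K T a \<in> carrier G" using assms(2) by (auto simp: right_transversal_def)
  have "a \<in> K #> rep G K T a" using 1(2) rcos_self[OF assms(3,1)] by simp
  thus "a \<otimes> inv (rep G K T a) \<in> K" by (rule subgroup.rcos_module_imp[OF assms(1) is_group 2])
qed

lemma rep_cong: "K #>\<^bsub>G\<^esub> a = K #>\<^bsub>G\<^esub> b \<Longrightarrow> rep G K T a = rep G K T b"
  by (simp add: rep_def)

text \<open>The image of \<one> is idempotent and injective on words, hence \<open>id\<close>;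
  normality then follows from multiplicativity.\<close>

lemma (in group) kernel_normal:
  assumes "\<phi> \<in> hom G (fs_group m)"
  shows "{g \<in> carrier G. \<phi> g = id} \<lhd> G" "\<phi> \<one> = id"
proof -
  have mult: "\<phi> (g \<otimes> h) = \<phi> h \<circ> \<phi> g" if "g \<in> carrier G" "h \<in> carrier G" for g h
    using assms that by (auto simp: hom_def)
  have aut: "tree_aut m (\<phi> \<one>)" using assms fs_tree_aut by (auto simp: hom_def)
  have "\<phi> \<one> w = w" for w
  proof (cases "w \<in> words m")
    case True
    have "\<phi> \<one> (\<phi> \<one> w) = \<phi> \<one> w" using fun_cong[OF mult[of \<one> \<one>], of w] by simp
    thus ?thesis using tree_aut_inject[OF aut tree_aut_words[OF aut True] True] by simp
  qed (rule tree_aut_outside[OF aut])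
  thus one: "\<phi> \<one> = id" by auto
  have inv: "\<phi> (inv g) \<circ> \<phi> g = id" if "g \<in> carrier G" for g
    using mult[of g "inv g"] that one by simp
  show "{g \<in> carrier G. \<phi> g = id} \<lhd> G"
  proof (rule normal_invI)
    show "subgroup {g \<in> carrier G. \<phi> g = id} G"
    proof (rule subgroupI)
      show "{g \<in> carrier G. \<phi> g = id} \<noteq> {}" using one by auto
      fix a assume "a \<in> {g \<in> carrier G. \<phi> g = id}"
      thus "inv a \<in> {g \<in> carrier G. \<phi> g = id}" using inv[of a] by auto
    qed (auto simp: mult)
    fix x h assume "x \<in> carrier G" "h \<in> {g \<in> carrier G. \<phi> g = id}"
    thus "x \<otimes> h \<otimes> inv x \<in> {g \<in> carrier G. \<phi> g = id}"
      using inv[of x] by (simp add: mult)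
  qed
qed

text \<open>The kernel is normal, lies in every \<open>H i\<close> and is invariant under every
  \<open>f i\<close>, so it is contained in the core, which is trivial.\<close>

lemma (in group) data_phi_hom_inj:
  assumes data: "G_data G s H f" and simple: "simple_data G s H f"
    and trans: "transversal_data G s H T e"
    and fin: "data_phi G s H f T e ` carrier G \<subseteq> fs (data_m G s H)"
  shows "data_phi G s H f T e \<in> hom G (fs_group (data_m G s H))"
    "inj_on (data_phi G s H f T e) (carrier G)"
proof -
  let ?M = "data_m G s H" and ?\<sigma> = "data_sigma G s H T e" and ?\<delta> = "data_sec G H f T e"
  let ?\<phi> = "data_phi G s H f T e"
  have H: "subgroup (H i) G" and f: "f i \<in> hom (G\<lparr>carrier := H i\<rparr>) G"
    and T: "right_transversal G (H i) (T i)" if "i < s" for i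
    using that data trans by (auto simp: G_data_def transversal_data_def)
  have cancel: "inv x \<otimes> (x \<otimes> y) = y" "x \<otimes> (inv x \<otimes> y) = y"
    if "x \<in> carrier G" "y \<in> carrier G" for x y
    using that by (simp_all flip: m_assoc)
  have e: "bij_betw e {..<?M} (SIGMA i:{..<s}. T i)"
    using trans by (simp add: transversal_data_def)
  have letter: "\<exists>i t. e j = (i, t) \<and> i < s \<and> t \<in> T i \<and> t \<in> carrier G" if "j < ?M" for j
  proof -
    have "e j \<in> (SIGMA i:{..<s}. T i)" using e that unfolding bij_betw_def by blast
    then obtain i t where "e j = (i, t)" "i < s" "t \<in> T i" by auto
    thus ?thesis using T[of i] by (auto simp: right_transversal_def)
  qed
  have index: "inv_into {..<?M} e (i, t) < ?M \<and> e (inv_into {..<?M} e (i, t)) = (i, t)"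
    if "i < s" "t \<in> T i" for i t
  proof -
    have "(i, t) \<in> e ` {..<?M}" using e that unfolding bij_betw_def by simp
    thus ?thesis using inv_into_into[of "(i, t)" e "{..<?M}"] f_inv_into_f[of "(i, t)" e "{..<?M}"] by simp
  qed
  have step: "?\<sigma> g j < ?M \<and> e (?\<sigma> g j) = (i, rep G (H i) (T i) (t \<otimes> g)) \<and> ?\<delta> g j \<in> carrier G"
    if g: "g \<in> carrier G" and e: "e j = (i, t)" and it: "i < s" "t \<in> carrier G" for g j i t
  proof -
    note r = rep_props[OF H[OF it(1)] T[OF it(1)], of "t \<otimes> g"]
    have "f i (t \<otimes> g \<otimes> inv (rep G (H i) (T i) (t \<otimes> g))) \<in> carrier G"
      using f[OF it(1)] r(4) g it by (auto simp: hom_def)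
    thus ?thesis using index[OF it(1) r(1)] g it by (simp add: data_sigma_def data_sec_def e)
  qed
  have mult: "?\<phi> (g \<otimes> h) = ?\<phi> h \<circ> ?\<phi> g" if "g \<in> carrier G" "h \<in> carrier G" for g h
    unfolding data_phi_eq_machine
  proof (rule machine_comp[where R = "\<lambda>g h k. g \<in> carrier G \<and> h \<in> carrier G \<and> k = g \<otimes> h"])
    fix g h k j assume "g \<in> carrier G \<and> h \<in> carrier G \<and> k = g \<otimes> h" and j: "j < ?M"
    hence gh: "g \<in> carrier G" "h \<in> carrier G" "k = g \<otimes> h" by auto
    obtain i t where t: "e j = (i, t)" "i < s" "t \<in> carrier G" using letter[OF j] by auto
    note r = rep_props[OF H[OF t(2)] T[OF t(2)]]
    define t' where "t' = rep G (H i) (T i) (t \<otimes> g)"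
    have t': "t' \<in> carrier G" "H i #> t' = H i #> (t \<otimes> g)" "t \<otimes> g \<otimes> inv t' \<in> H i"
      using r(2-4)[of "t \<otimes> g"] gh t by (simp_all add: t'_def)
    have ej: "e (?\<sigma> g j) = (i, t')" "?\<sigma> g j < ?M" "?\<delta> g j \<in> carrier G"
      using step[OF gh(1) t] by (simp_all add: t'_def)
    have sub: "H i \<subseteq> carrier G" by (rule subgroup.subset[OF H[OF t(2)]])
    \<comment> \<open>Moving \<open>t\<close> by \<open>g\<close> and then by \<open>h\<close> ends
      in the coset reached by \<open>k\<close> in one step, so both ways choose the same
      representative.\<close>
    have "H i #> (t \<otimes> k) = (H i #> (t \<otimes> g)) #> h"
      using sub gh t by (simp add: coset_mult_assoc m_assoc)
    also have "\<dots> = H i #> (t' \<otimes> h)"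
      unfolding t'(2)[symmetric] by (rule coset_mult_assoc[OF sub t'(1) gh(2)])
    finally have rep: "rep G (H i) (T i) (t \<otimes> k) = rep G (H i) (T i) (t' \<otimes> h)" by (rule rep_cong)
    define t'' where "t'' = rep G (H i) (T i) (t' \<otimes> h)"
    have t'': "t'' \<in> carrier G" "t' \<otimes> h \<otimes> inv t'' \<in> H i"
      using r(2,4)[of "t' \<otimes> h"] gh t' by (simp_all add: t''_def)
    \<comment> \<open>The cocycle identity for \<open>\<theta>_i\<close>; both factors lie in
      \<open>H i\<close>, so \<open>f i\<close> may be applied to each.\<close>
    have "t \<otimes> k \<otimes> inv t'' = (t \<otimes> g \<otimes> inv t') \<otimes> (t' \<otimes> h \<otimes> inv t'')"
      using gh t t'(1) t''(1) by (simp add: m_assoc cancel)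
    hence "f i (t \<otimes> k \<otimes> inv t'') = f i (t \<otimes> g \<otimes> inv t') \<otimes> f i (t' \<otimes> h \<otimes> inv t'')"
      using f[OF t(2)] t'(3) t''(2) by (auto simp: hom_def)
    hence "?\<delta> k j = ?\<delta> g j \<otimes> ?\<delta> h (?\<sigma> g j)"
      by (simp add: data_sec_def t(1) ej(1) rep flip: t'_def t''_def)
    moreover have "?\<sigma> k j = ?\<sigma> h (?\<sigma> g j)"
      by (simp add: data_sigma_def[where k = "?\<sigma> g j"] data_sigma_def[where g = k] t(1) ej(1) rep)
    moreover have "?\<delta> h (?\<sigma> g j) \<in> carrier G"
      using step[OF gh(2) ej(1) t(2) t'(1)] by simp
    ultimately show "?\<sigma> g j < ?M \<and> ?\<sigma> k j = ?\<sigma> h (?\<sigma> g j) \<and>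
        ?\<delta> g j \<in> carrier G \<and> ?\<delta> h (?\<sigma> g j) \<in> carrier G \<and> ?\<delta> k j = ?\<delta> g j \<otimes> ?\<delta> h (?\<sigma> g j)"
      using ej by simp
  qed (use that in simp)
  show hom: "?\<phi> \<in> hom G (fs_group ?M)" using fin mult by (auto simp: hom_def)
  define K where "K = {g \<in> carrier G. ?\<phi> g = id}"
  have K: "K \<lhd> G" and one: "?\<phi> \<one> = id" using kernel_normal[OF hom] by (simp_all add: K_def)
  have Kinv: "K \<subseteq> H i \<and> f i ` K \<subseteq> K" if i: "i < s" for i
  proof -
    note r = rep_props[OF H[OF i] T[OF i]]
    \<comment> \<open>The representative of \<open>H i\<close> itself, which may differ from \<one>.
      A kernel element \<open>k\<close> fixes the letter of \<open>t\<close>, which places the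
      conjugate of \<open>k\<close> by \<open>t\<close> in \<open>H i\<close>.\<close>
    define t where "t = rep G (H i) (T i) \<one>"
    have t: "t \<in> T i" "t \<in> carrier G" using r(1,2)[of \<one>] by (simp_all add: t_def)
    have "inv t \<in> H i" using r(4)[of \<one>] t(2) by (simp flip: t_def)
    hence tH: "t \<in> H i" using subgroup.m_inv_closed[OF H[OF i]] t(2) by fastforce
    define j where "j = inv_into {..<?M} e (i, t)"
    have j: "j < ?M" "e j = (i, t)" using index[OF i t(1)] by (simp_all add: j_def)
    have K_letter: "rep G (H i) (T i) (t \<otimes> k) = t \<and> ?\<delta> k j \<in> K" if k: "k \<in> K" for k
    proof -
      have kG: "k \<in> carrier G" using k by (simp add: K_def)
      note st = step[OF kG j(2) i t(2)]
      have eq: "?\<sigma> k j # run ?\<sigma> ?\<delta> (?\<delta> k j) w = j # w" if w: "w \<in> words ?M" for w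
      proof -
        have "?\<phi> k (j # w) = j # w" using k by (simp add: K_def)
        thus ?thesis using w j(1) by (simp add: data_phi_eq_machine machine_def)
      qed
      have "?\<phi> (?\<delta> k j) = id" using eq by (auto simp: data_phi_eq_machine machine_def)
      thus ?thesis using st eq[of "[]"] j(2) by (simp add: K_def)
    qed
    have "k \<in> H i" if k: "k \<in> K" for k
    proof -
      have kG: "k \<in> carrier G" using k by (simp add: K_def)
      have "t \<otimes> k \<otimes> inv t \<in> H i" using r(4)[of "t \<otimes> k"] K_letter[OF k] kG t(2) by simp
      hence "inv t \<otimes> (t \<otimes> k \<otimes> inv t) \<otimes> t \<in> H i"
        using tH H[OF i] by (simp add: subgroup.m_closed subgroup.m_inv_closed)
      moreover have "inv t \<otimes> (t \<otimes> k \<otimes> inv t) \<otimes> t = k"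
        using kG t(2) by (simp add: m_assoc cancel)
      ultimately show ?thesis by simp
    qed
    moreover have "f i k \<in> K" if k: "k \<in> K" for k
    proof -
      have kG: "k \<in> carrier G" using k by (simp add: K_def)
      \<comment> \<open>Conjugating beforehand cancels the conjugation by \<open>t\<close> in the
        state, which becomes exactly \<open>f i k\<close>.\<close>
      have k': "inv t \<otimes> k \<otimes> t \<in> K" using normal.inv_op_closed1[OF K t(2) k] .
      have "t \<otimes> (inv t \<otimes> k \<otimes> t) \<otimes> inv t = k" using kG t(2) by (simp add: m_assoc cancel)
      hence "?\<delta> (inv t \<otimes> k \<otimes> t) j = f i k"
        using K_letter[OF k'] by (simp add: data_sec_def j(2))
      thus ?thesis using K_letter[OF k'] by simp
    qed
    ultimately show ?thesis by blast
  qed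
  have "K \<subseteq> F_core G s H f"
  proof
    fix k assume k: "k \<in> K"
    have "K \<subseteq> carrier G \<inter> (\<Inter>i\<in>{..<s}. H i)" using Kinv by (auto simp: K_def)
    thus "k \<in> F_core G s H f"
      unfolding F_core_def using k K Kinv by (intro generate.incl UnionI[of K]) auto
  qed
  hence K1: "K \<subseteq> {\<one>}" using simple by (simp add: simple_data_def)
  show "inj_on ?\<phi> (carrier G)"
  proof (rule inj_onI)
    fix g h assume gh: "g \<in> carrier G" "h \<in> carrier G" "?\<phi> g = ?\<phi> h"
    have "?\<phi> (g \<otimes> inv h) = ?\<phi> (h \<otimes> inv h)"
      using mult[OF gh(1) inv_closed[OF gh(2)]] mult[OF gh(2) inv_closed[OF gh(2)]] gh(3) by metis
    hence "g \<otimes> inv h \<in> K" using gh one by (simp add: K_def)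
    hence "g \<otimes> inv h = \<one>" using K1 by blast
    thus "g = h" using gh inv_equality by (metis inv_closed inv_inv)
  qed
qed

section \<open>Assembling the embedding\<close>

theorem theoremC:
  fixes A :: "('a, 'c) monoid_scheme" and G :: "('g, 'd) monoid_scheme"
  assumes "comm_group A"
    and "\<exists>S. finite S \<and> S \<subseteq> carrier A \<and> generate A S = carrier A"
    and "group G"
    and "\<exists>g\<in>carrier G. \<forall>n::nat. 0 < n \<longrightarrow> g [^]\<^bsub>G\<^esub> n \<noteq> \<one>\<^bsub>G\<^esub>"
    and "\<exists>s H f. G_data G s H f \<and> simple_data G s H f
           \<and> (\<exists>T e. transversal_data G s H T e
                \<and> self_similar (data_m G s H) (data_phi G s H f T e ` carrier G)
                \<and> data_phi G s H f T e ` carrier G \<subseteq> carrier (fs_group (data_m G s H)))"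
  shows "\<exists>n\<ge>2. \<exists>h. h \<in> hom (wreath A G) (fs_group n) \<and> inj_on h (carrier (wreath A G))"
proof -
  interpret A: comm_group A by fact
  interpret G: group G by fact
  obtain s H f T e where data: "G_data G s H f" "simple_data G s H f" "transversal_data G s H T e"
      "data_phi G s H f T e ` carrier G \<subseteq> fs (data_m G s H)"
    using assms(5) by blast
  define \<phi> M where "\<phi> = data_phi G s H f T e" and "M = data_m G s H"
  have \<phi>: "\<phi> \<in> hom G (fs_group M)" "inj_on \<phi> (carrier G)"
    using G.data_phi_hom_inj[OF data] by (simp_all add: \<phi>_def M_def)
  obtain \<psi> where \<psi>: "\<psi> \<in> hom (fs_group M) (fs_group (Suc M))"
    "\<And>F. finite F \<Longrightarrow> F \<subseteq> fs M \<Longrightarrow> \<exists>w\<in>words (Suc M). inj_on (\<lambda>g. \<psi> g w) F"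
    using fs_group_separating_embedding[of M] by blast
  obtain k where k: "fs_embeddable (A\<lparr>carrier := carrier A\<rparr>) k"
    using assms(2) A.fs_embeddable_generate by (elim exE conjE) metis
  \<comment> \<open>\<open>k\<close> letters for \<open>A\<close>; on the other side all pairs over
    the \<open>Suc M\<close> letters (the reset letter included) and one terminator.\<close>
  define n where "n = max k (Suc (Suc M * Suc M))"
  have "fs_embeddable (A\<lparr>carrier := carrier A\<rparr>) n"
    by (rule fs_embeddable_mono[OF k]) (simp add: n_def)
  then obtain \<eta> where \<eta>: "\<eta> \<in> hom A (fs_group n)" "inj_on \<eta> (carrier A)"
    by (auto simp: fs_embeddable_def hom_def)
  interpret fs_wreath A G "Suc M" n "\<psi> \<circ> \<phi>" \<eta>
  proof
    show "\<psi> \<circ> \<phi> \<in> hom G (fs_group (Suc M))" by (rule hom_compose[OF \<phi>(1) \<psi>(1)])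
    show "\<exists>w\<in>words (Suc M). inj_on (\<lambda>g. (\<psi> \<circ> \<phi>) g w) F" if F: "finite F" "F \<subseteq> carrier G" for F
    proof -
      have "\<phi> ` F \<subseteq> fs M" using F(2) \<phi>(1) by (auto simp: hom_def)
      then obtain w where w: "w \<in> words (Suc M)" "inj_on (\<lambda>g. \<psi> g w) (\<phi> ` F)"
        using \<psi>(2)[of "\<phi> ` F"] F(1) by auto
      have "inj_on ((\<lambda>g. \<psi> g w) \<circ> \<phi>) F"
        by (rule comp_inj_on[OF inj_on_subset[OF \<phi>(2) F(2)] w(2)])
      thus ?thesis using w(1) by (auto simp: comp_def)
    qed
  qed (use \<eta> in \<open>auto simp: n_def\<close>)
  have "n \<ge> 2" by (simp add: n_def)
  thus ?thesis using emb_hom emb_inj by blast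
qed

end
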